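(* Let $Q:\mathbf{T}\to\mathbb{R}$ be a $C^{3}$ potential such that $Q''\ge \rho-\frac12$ on $\mathbf{T}$ for some $\rho>0$, and let $\mu_Q$ be its equilibrium measure. Then for any smooth function $\phi$ on $\mathbf{T}$, $$2\rho\iint\left|\frac{\phi(z)-\phi(w)}{z-w}\right|^{2}\alpha(dz)\,\alpha(dw)\le \int\left|\phi'-\int\phi'\,d\mu_Q\right|^{2}d\mu_Q .$$
   Context: $\mathbf{T}$ is the unit circle in $\mathbb{C}$ and $\alpha$ is the normalized (probability) Haar measure on $\mathbf{T}$. For a differentiable function $\phi$ on $\mathbf{T}$, $\phi'(z)=\frac{d}{dt}\big|_{t=0}\phi(ze^{it})$, and higher derivatives are defined by iterating. For a continuous $Q:\mathbf{T}\to\mathbb{R}$ (a potential) and a probability measure $\mu$ on $\mathbf{T}$, $E_Q(\mu)=\int Q\,d\mu-\iint\log|x-y|\,\mu(dx)\mu(dy)$. It is known that $E_Q$ has a unique minimizer $\mu_Q$ among probability measures on $\mathbf{T}$, called the equilibrium measure of $Q$. *)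

theory Defs
  imports "HOL-Probability.Probability"
begin

abbreviation circle :: "complex set" where
  "circle \<equiv> sphere 0 1"

abbreviation circle_borel :: "complex measure" where
  "circle_borel \<equiv> restrict_space borel circle"

definition circle_prob :: "complex measure \<Rightarrow> bool" where
  "circle_prob \<mu> \<longleftrightarrow> prob_space \<mu> \<and> sets \<mu> = sets circle_borel"

text \<open>
  Normalized Haar measure on the circle, as normalized arc length; the lemmas
  \<open>circle_prob_circle_haar\<close> and \<open>circle_haar_rotate\<close> show that it is a
  rotation-invariant probability measure, which characterizes it.
\<close>

definition circle_haar :: "complex measure" where
  "circle_haar = distr (uniform_measure lborel {0..<2 * pi}) circle_borel cis"

lemma cis_measurable [measurable]: "cis \<in> borel \<rightarrow>\<^sub>M circle_borel"
  by (rule measurable_restrict_space2)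
     (auto simp: continuous_on_cis intro!: borel_measurable_continuous_onI)

lemma emeasure_circle_haar:
  assumes A: "A \<in> sets circle_borel"
  shows "emeasure circle_haar A = emeasure lborel ({0..<2 * pi} \<inter> cis -` A) / (2 * pi)"
proof -
  have m: "cis -` A \<in> sets borel"
    using measurable_sets[OF cis_measurable A] by simp
  show ?thesis
    using A m by (simp add: circle_haar_def emeasure_distr)
qed

lemma circle_prob_circle_haar: "circle_prob circle_haar"
proof -
  have "prob_space (uniform_measure lborel {0..<2 * pi})"
    by (rule prob_space_uniform_measure) auto
  then have "prob_space circle_haar"
    unfolding circle_haar_def by (rule prob_space.prob_space_distr) simp
  then show ?thesis
    by (simp add: circle_prob_def circle_haar_def)
qed

lemma emeasure_lborel_translate:
  fixes X :: "real set"
  assumes "X \<in> sets borel"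
  shows "emeasure lborel ((\<lambda>t. s + t) -` X) = emeasure lborel X"
proof -
  have "emeasure lborel X = emeasure (distr lborel borel ((+) s)) X"
    by (simp add: lborel_distr_plus)
  also have "\<dots> = emeasure lborel ((\<lambda>t. s + t) -` X)"
    using assms by (subst emeasure_distr) auto
  finally show ?thesis by simp
qed

lemma circle_haar_rotate:
  assumes c: "c \<in> circle"
  shows "distr circle_haar circle_borel (\<lambda>z. c * z) = circle_haar"
proof (rule measure_eqI)
  show "sets (distr circle_haar circle_borel (\<lambda>z. c * z)) = sets circle_haar"
    by (simp add: circle_haar_def)
next
  fix A assume "A \<in> sets (distr circle_haar circle_borel (\<lambda>z. c * z))"
  then have A: "A \<in> sets circle_borel" by simp
  obtain s where s: "0 \<le> s" "s < 2 * pi" "c = cis s"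
    using c cis_Arg_unique Arg2pi_ge_0 Arg2pi_lt_2pi Arg2pi_eq
    by (metis cis_conv_exp complex_norm_eq_1_exp dist_0_norm mem_sphere mult.left_neutral of_real_1)
  define B where "B = cis -` A"
  have B: "B \<in> sets borel"
    using measurable_sets[OF cis_measurable A] by (simp add: B_def)
  have per: "t + 2 * pi \<in> B \<longleftrightarrow> t \<in> B" for t
    by (simp add: B_def cis_mult[symmetric])
  have rot: "(\<lambda>z. c * z) \<in> circle_borel \<rightarrow>\<^sub>M circle_borel"
    using c by (intro measurable_restrict_space3) (auto simp: norm_mult)
  have sets: "sets circle_haar = sets circle_borel"
    by (simp add: circle_haar_def)
  have space: "space circle_haar = circle"
    by (simp add: circle_haar_def space_restrict_space)
  have pre: "(\<lambda>z. c * z) -` A \<inter> circle \<in> sets circle_borel"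
    using measurable_sets[OF rot A] by (simp add: space_restrict_space)
  have I: "{0..<2 * pi} \<inter> cis -` ((\<lambda>z. c * z) -` A \<inter> circle)
      = (\<lambda>t. s + t) -` (B \<inter> {s..<2 * pi + s})"
    by (auto simp: B_def s cis_mult)
  have "emeasure lborel ({0..<2 * pi} \<inter> cis -` ((\<lambda>z. c * z) -` A \<inter> circle))
      = emeasure lborel (B \<inter> {s..<2 * pi + s})"
    using B unfolding I by (intro emeasure_lborel_translate) auto
  also have "B \<inter> {s..<2 * pi + s} = (B \<inter> {s..<2 * pi}) \<union> (B \<inter> {2 * pi..<2 * pi + s})"
    using s by auto
  also have "emeasure lborel \<dots>
      = emeasure lborel (B \<inter> {s..<2 * pi}) + emeasure lborel (B \<inter> {2 * pi..<2 * pi + s})"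
    using B by (intro plus_emeasure[symmetric]) auto
  also have "emeasure lborel (B \<inter> {2 * pi..<2 * pi + s})
      = emeasure lborel ((\<lambda>t. 2 * pi + t) -` (B \<inter> {2 * pi..<2 * pi + s}))"
    using B by (intro emeasure_lborel_translate[symmetric]) auto
  also have "(\<lambda>t. 2 * pi + t) -` (B \<inter> {2 * pi..<2 * pi + s}) = B \<inter> {0..<s}"
    using per by (auto simp: add.commute)
  also have "emeasure lborel (B \<inter> {s..<2 * pi}) + emeasure lborel (B \<inter> {0..<s})
      = emeasure lborel ((B \<inter> {s..<2 * pi}) \<union> (B \<inter> {0..<s}))"
    using B by (intro plus_emeasure) auto
  also have "(B \<inter> {s..<2 * pi}) \<union> (B \<inter> {0..<s}) = {0..<2 * pi} \<inter> B"
    using s by auto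
  finally have "emeasure lborel ({0..<2 * pi} \<inter> cis -` ((\<lambda>z. c * z) -` A \<inter> circle))
      = emeasure lborel ({0..<2 * pi} \<inter> cis -` A)"
    by (simp only: B_def)
  then show "emeasure (distr circle_haar circle_borel (\<lambda>z. c * z)) A = emeasure circle_haar A"
    using rot A pre sets space
    by (simp add: emeasure_distr emeasure_circle_haar measurable_cong_sets[OF sets refl])
qed

definition circle_deriv :: "(complex \<Rightarrow> 'a::real_normed_vector) \<Rightarrow> complex \<Rightarrow> 'a" where
  "circle_deriv f z = vector_derivative (\<lambda>t. f (z * cis t)) (at 0)"

primrec C_k_on_circle :: "nat \<Rightarrow> (complex \<Rightarrow> 'a::real_normed_vector) \<Rightarrow> bool" where
  "C_k_on_circle 0 f \<longleftrightarrow> continuous_on circle f"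
| "C_k_on_circle (Suc k) f \<longleftrightarrow>
     (\<forall>z\<in>circle. (\<lambda>t. f (z * cis t)) differentiable (at 0)) \<and> C_k_on_circle k (circle_deriv f)"

definition smooth_on_circle :: "(complex \<Rightarrow> 'a::real_normed_vector) \<Rightarrow> bool" where
  "smooth_on_circle f \<longleftrightarrow> (\<forall>k. C_k_on_circle k f)"

definition log_dist :: "'a::metric_space \<Rightarrow> 'a \<Rightarrow> ereal" where
  "log_dist x y = (if x = y then - \<infinity> else ereal (ln (dist x y)))"

text \<open>
  Integral of an extended-real function as the integral of the positive part minus that of
  the negative part (\<^const>\<open>e2ennreal\<close> truncates negative values to 0). It is meaningful
  only if one of the two is finite; below the positive part is bounded, since
  \<open>log_dist x y \<le> ln 2\<close> on the circle. The Bochner integral is not suitable here because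
  it is 0 on non-integrable functions.
\<close>

definition ereal_integral :: "'a measure \<Rightarrow> ('a \<Rightarrow> ereal) \<Rightarrow> ereal" where
  "ereal_integral M f =
     enn2ereal (\<integral>\<^sup>+ x. e2ennreal (f x) \<partial>M) - enn2ereal (\<integral>\<^sup>+ x. e2ennreal (- f x) \<partial>M)"

definition log_energy :: "(complex \<Rightarrow> real) \<Rightarrow> complex measure \<Rightarrow> ereal" where
  "log_energy Q \<mu> =
     ereal (LINT x|\<mu>. Q x) - ereal_integral (\<mu> \<Otimes>\<^sub>M \<mu>) (\<lambda>(x, y). log_dist x y)"

definition is_equilibrium_measure :: "(complex \<Rightarrow> real) \<Rightarrow> complex measure \<Rightarrow> bool" where
  "is_equilibrium_measure Q \<mu> \<longleftrightarrow>
     circle_prob \<mu> \<and> (\<forall>\<nu>. circle_prob \<nu> \<longrightarrow> log_energy Q \<mu> \<le> log_energy Q \<nu>)"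

end

theory Submission
  imports Defs
begin

text \<open>
  The constant \<open>2 \<rho>\<close> is a lower bound for the density of \<open>\<mu>\<^sub>Q\<close> with respect to \<open>\<alpha>\<close>, which
  reduces the claim to the case of \<open>\<alpha>\<close>.  On the Fourier side \<open>E\<^sub>Q(\<mu>)\<close> equals
  \<open>\<integral> Q d\<mu> + \<Sum>\<^sub>k |\<mu>\<^sub>k|\<^sup>2 / k\<close> (over \<open>k \<ge> 1\<close>) with \<open>\<mu>\<^sub>k = \<integral> z\<^sup>k d\<mu>\<close>, so completing the square identifies
  \<open>\<mu>\<^sub>Q\<close> as \<open>f \<alpha>\<close> with \<open>f(z) = 1 - 2 \<integral> ln |z - w| Q''(w) \<alpha>(dw)\<close>, as soon as this \<open>f\<close> is
  nonnegative.  Put \<open>\<lambda> = 1/2 - \<rho>\<close>.  Since \<open>Q''\<close> and \<open>ln |z - \<cdot>|\<close> have mean zero, \<open>Q'' + \<lambda> \<ge> 0\<close>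
  has mass \<open>\<lambda> \<ge> 0\<close>, and \<open>|z - w| \<le> 2\<close> gives \<open>f \<ge> 1 - 2 \<lambda> ln 2 \<ge> 1 - 2 \<lambda> = 2 \<rho>\<close>.  Finally, for
  fixed \<open>u\<close> on the circle Parseval's identity and \<open>|u\<^sup>n - 1| \<le> |n| |u - 1|\<close> yield
  \<open>\<integral> |\<phi>(uz) - \<phi>(z)|\<^sup>2 \<alpha>(dz) \<le> |u - 1|\<^sup>2 \<integral> |\<phi>' - c|\<^sup>2 d\<alpha>\<close> for every constant \<open>c\<close>.
\<close>

section \<open>Integration on the circle\<close>

text \<open>The obstacle is that \<open>\<mu>\<close> comes with no regularity: it is just a
  minimizer among all probability measures, its energy lives in \<open>ereal\<close>, and the kernel
  is unbounded at the diagonal. The Fourier form of the energy is therefore established as two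
  one-sided bounds, both through the truncated kernel \<open>log_kernel s\<close>:
  \<open>log_energy_ge\<close> for an arbitrary measure, and \<open>log_energy_le\<close> for a
  measure whose weighted moment series converges. Minimality of \<open>\<mu>\<close> against the
  candidate links the two. The weights 1/k come from the expansion of -ln |1 - e^(it)| as the sum
  over k >= 1 of cos(k t)/k. What this yields is equality of all moments. It transfers to integrals
  of C^1 functions, whose Fourier coefficients are absolutely summable, and the integrand |\<phi>' -
  c|^2 is such a function. The third derivative of \<open>Q\<close> enters in the same way: it makes
  the coefficients of Q'' absolutely summable, so that the density is given by a convergent
  series.\<close>

lemma space_circle_prob: "circle_prob M \<Longrightarrow> space M = circle"
  unfolding circle_prob_def by (metis sets_eq_imp_space_eq space_restrict_space space_borel inf_top_right)

lemma circle_prob_prob_space: "circle_prob M \<Longrightarrow> prob_space M"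
  by (simp add: circle_prob_def)

lemma circle_prob_sets: "circle_prob M \<Longrightarrow> sets M = sets circle_borel"
  by (simp add: circle_prob_def)

lemma measurable_continuous_circle:
  fixes g :: "complex \<Rightarrow> 'b::topological_space"
  assumes "circle_prob M" "continuous_on circle g"
  shows "g \<in> borel_measurable M"
  using borel_measurable_continuous_on_restrict[OF assms(2)] circle_prob_sets[OF assms(1)]
  by (simp cong: measurable_cong_sets)

lemma integrable_bounded_circle:
  fixes g :: "complex \<Rightarrow> 'b::{banach,second_countable_topology}"
  assumes "circle_prob M" "g \<in> borel_measurable M" "\<And>z. z \<in> circle \<Longrightarrow> norm (g z) \<le> B"
  shows "integrable M g"
proof -
  interpret prob_space M using assms(1) by (rule circle_prob_prob_space)
  show ?thesis
    by (rule integrable_const_bound[of _ B]) (use assms space_circle_prob in auto)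
qed

lemma continuous_circle_bounded:
  fixes g :: "complex \<Rightarrow> 'b::real_normed_vector"
  assumes "continuous_on circle g"
  obtains B where "B \<ge> 0" "\<And>z. z \<in> circle \<Longrightarrow> norm (g z) \<le> B"
proof -
  have "compact (g ` circle)"
    by (intro compact_continuous_image assms) auto
  then obtain B where "\<forall>x\<in>g ` circle. norm x \<le> B"
    using compact_imp_bounded bounded_iff by blast
  then show ?thesis
    by (intro that[of "max 0 B"]) force+
qed

lemma integrable_continuous_circle:
  fixes g :: "complex \<Rightarrow> 'b::{banach,second_countable_topology}"
  assumes "circle_prob M" "continuous_on circle g"
  shows "integrable M g"
  using integrable_bounded_circle[OF assms(1) measurable_continuous_circle[OF assms]]
    continuous_circle_bounded[OF assms(2)] by metis

lemma continuous_on_circle_powi [continuous_intros]: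
  fixes g :: "complex \<Rightarrow> complex"
  assumes "continuous_on circle g" "\<And>z. z \<in> circle \<Longrightarrow> g z \<noteq> 0"
  shows "continuous_on circle (\<lambda>z. g z powi k)"
  by (rule continuous_on_power_int) (use assms in auto)

lemma circle_mult_cnj: "z \<in> circle \<Longrightarrow> z * cnj z = 1"
  by (simp add: complex_norm_square[symmetric])

lemma circle_nonzero: "z \<in> circle \<Longrightarrow> z \<noteq> 0" for z :: complex
  by auto

lemma cnj_circle: "z \<in> circle \<Longrightarrow> cnj z = inverse z"
  using circle_mult_cnj[of z] circle_nonzero[of z] by (simp add: field_simps)

lemma cnj_powi_circle: "z \<in> circle \<Longrightarrow> cnj (z powi k) = z powi (- k)"
  by (simp only: complex_cnj_power_int cnj_circle power_int_inverse power_int_minus)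

lemma circle_cisE:
  assumes "z \<in> circle" obtains t where "z = cis t" "\<bar>t\<bar> \<le> pi"
proof -
  have "z \<noteq> 0" "norm z = 1" using assms by auto
  then have "z = cis (Arg z)"
    by (metis cis_Arg sgn_eq div_by_1 of_real_1)
  then show ?thesis using that[of "Arg z"] Arg_bounded[of z] by fastforce
qed

lemma integral_circle_haar_rotate:
  fixes g :: "complex \<Rightarrow> 'b::{banach,second_countable_topology}"
  assumes "g \<in> borel_measurable circle_haar" "c \<in> circle"
  shows "(LINT z|circle_haar. g (c * z)) = (LINT z|circle_haar. g z)"
proof -
  have s: "sets circle_haar = sets circle_borel"
    by (simp add: circle_haar_def)
  have rot: "(\<lambda>z. c * z) \<in> circle_borel \<rightarrow>\<^sub>M circle_borel"
    using assms(2) by (intro measurable_restrict_space3) (auto simp: norm_mult)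
  have "(LINT z|circle_haar. g z) = (LINT z|distr circle_haar circle_borel (\<lambda>z. c * z). g z)"
    by (simp add: circle_haar_rotate[OF assms(2)])
  also have "\<dots> = (LINT z|circle_haar. g (c * z))"
    by (rule integral_distr) (use rot assms(1) s in \<open>simp_all cong: measurable_cong_sets\<close>)
  finally show ?thesis by simp
qed

text \<open>Rotation invariance alone gives orthogonality: rotating by a \<open>c\<close> with
  \<open>c powi k = -1\<close> turns the integral into its own negative.\<close>

lemma integral_circle_haar_powi: "(LINT z|circle_haar. z powi k) = of_bool (k = 0)"
proof (cases "k = 0")
  case True
  interpret prob_space circle_haar
    using circle_prob_circle_haar by (rule circle_prob_prob_space)
  show ?thesis using True by (simp add: prob_space)
next
  case False
  define c where "c = cis (pi / of_int k)"
  have ck: "c powi k = -1" using False by (simp add: c_def cis_power_int)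
  have "(LINT z|circle_haar. (c * z) powi k) = (LINT z|circle_haar. z powi k)"
    by (rule integral_circle_haar_rotate)
       (auto intro!: measurable_continuous_circle circle_prob_circle_haar continuous_intros simp: c_def)
  then show ?thesis using False
    by (simp add: power_int_mult_distrib ck)
qed

text \<open>The closed interval is the form that the fundamental theorem of calculus takes; it
  differs from the half-open one in \<open>circle_haar\<close> by the null set
  \<open>{2 * pi}\<close>.\<close>

lemma integral_circle_haar_cis:
  fixes g :: "complex \<Rightarrow> 'b::{banach,second_countable_topology}"
  assumes "g \<in> borel_measurable circle_haar"
  shows "(LINT z|circle_haar. g z)
    = (1 / (2 * pi)) *\<^sub>R (LINT t|lborel. indicator {0..2 * pi} t *\<^sub>R g (cis t))"
proof -
  have g: "g \<in> borel_measurable circle_borel"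
    using assms by (simp add: circle_haar_def)
  have [measurable]: "(\<lambda>t. g (cis t)) \<in> borel_measurable borel"
    using measurable_compose[OF cis_measurable g] .
  have "uniform_measure lborel {0..<2*pi}
      = density lborel (\<lambda>t. ennreal (indicator {0..<2*pi} t / (2 * pi)))"
    unfolding uniform_measure_def
    by (rule density_cong) (auto simp: indicator_def divide_ennreal[symmetric] ennreal_mult' ennreal_1[symmetric] simp del: ennreal_1)
  then have "(LINT z|circle_haar. g z)
    = (LINT t|density lborel (\<lambda>t. ennreal (indicator {0..<2*pi} t / (2 * pi))). g (cis t))"
    unfolding circle_haar_def using g by (subst integral_distr) auto
  also have "\<dots> = (LINT t|lborel. (indicator {0..<2*pi} t / (2 * pi)) *\<^sub>R g (cis t))"
    by (rule integral_density) auto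
  also have "\<dots> = (LINT t|lborel. (1 / (2 * pi)) *\<^sub>R (indicator {0..2 * pi} t *\<^sub>R g (cis t)))"
  proof (rule integral_cong_AE)
    show "AE t in lborel. (indicator {0..<2*pi} t / (2 * pi)) *\<^sub>R g (cis t)
        = (1 / (2 * pi)) *\<^sub>R (indicator {0..2 * pi} t *\<^sub>R g (cis t))"
      using AE_lborel_singleton[of "2*pi"] by eventually_elim (auto simp: indicator_def)
  qed auto
  also have "\<dots> = (1 / (2 * pi)) *\<^sub>R (LINT t|lborel. indicator {0..2 * pi} t *\<^sub>R g (cis t))"
    by (rule integral_scaleR_right)
  finally show ?thesis .
qed

text \<open>A relation rather than an operator: products, rotations and conjugates are handled by
  the derivative rules in the angle, with no value of \<open>circle_deriv\<close> to compute. Real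
  functions enter through their complex embedding, so that one Fourier theory serves all.\<close>

definition circle_C1 :: "(complex \<Rightarrow> complex) \<Rightarrow> (complex \<Rightarrow> complex) \<Rightarrow> bool" where
  "circle_C1 g g' \<longleftrightarrow> continuous_on circle g' \<and>
     (\<forall>t. ((\<lambda>t. g (cis t)) has_vector_derivative g' (cis t)) (at t))"

lemma integral_circle_haar_deriv:
  assumes "circle_C1 g g'"
  shows "(LINT z|circle_haar. g' z) = 0"
proof -
  have c: "continuous_on circle g'"
    and d: "((\<lambda>t. g (cis t)) has_vector_derivative g' (cis t)) (at t)" for t
    using assms by (auto simp: circle_C1_def)
  have cc: "continuous_on {0..2*pi} (\<lambda>t. g' (cis t))"
    by (rule continuous_on_compose2[OF c]) (auto intro!: continuous_intros)
  have "has_bochner_integral lborel (\<lambda>t. indicator {0..2*pi} t *\<^sub>R g' (cis t)) (g (cis (2*pi)) - g (cis 0))"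
    by (rule has_bochner_integral_FTC_Icc) (use cc in \<open>auto intro: has_vector_derivative_at_within[OF d]\<close>)
  then have "(LINT t|lborel. indicator {0..2*pi} t *\<^sub>R g' (cis t)) = 0"
    by (simp add: has_bochner_integral_iff)
  then show ?thesis
    using integral_circle_haar_cis[OF measurable_continuous_circle[OF circle_prob_circle_haar c]] by simp
qed

text \<open>Concavity of the sine: on this interval its graph lies above the chord joining its end
  points.\<close>

lemma jordan_sin_ge:
  fixes x :: real assumes "0 \<le> x" "x \<le> pi / 2" shows "2 * x / pi \<le> sin x"
proof -
  have "convex_on {0..pi/2} (\<lambda>x. - sin x)"
    by (rule f''_ge0_imp_convex[where f' = "\<lambda>x. - cos x" and f'' = sin])
       (auto intro!: derivative_eq_intros sin_ge_zero)
  from convex_onD[OF this, of "2 * x / pi" 0 "pi/2"] show ?thesis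
    using assms by (auto simp: field_simps)
qed

text \<open>The chord has length \<open>2 * sin (|t| / 2)\<close>, and Jordan's inequality compares
  it with the arc.\<close>

lemma norm_cis_minus_one_ge:
  assumes "\<bar>t\<bar> \<le> pi" shows "2 / pi * \<bar>t\<bar> \<le> norm (cis t - 1)"
proof -
  have "(norm (cis t - 1))\<^sup>2 = (2 * sin (\<bar>t\<bar> / 2))\<^sup>2"
  proof -
    have "(norm (cis t - 1))\<^sup>2 = (cos t - 1)\<^sup>2 + (sin t)\<^sup>2"
      by (simp add: cmod_power2)
    also have "\<dots> = 2 - 2 * cos (2 * (\<bar>t\<bar> / 2))"
      using sin_cos_squared_add[of t] by (simp add: power2_diff)
    also have "\<dots> = (2 * sin (\<bar>t\<bar> / 2))\<^sup>2"
      by (subst cos_double_sin) (simp add: power_mult_distrib)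
    finally show ?thesis .
  qed
  moreover have "0 \<le> sin (\<bar>t\<bar> / 2)" using assms by (intro sin_ge_zero) auto
  ultimately have "norm (cis t - 1) = 2 * sin (\<bar>t\<bar> / 2)"
    by (metis norm_ge_zero power2_eq_imp_eq mult_nonneg_nonneg zero_le_numeral)
  moreover have "2 * (\<bar>t\<bar> / 2) / pi \<le> sin (\<bar>t\<bar> / 2)"
    using assms by (intro jordan_sin_ge) auto
  ultimately show ?thesis by (simp add: field_simps)
qed

text \<open>The mean value bound in the angle gives a multiple of the arc length, and an arc of
  length at most pi is at most pi/2 times its chord. This keeps difference quotients bounded up to
  the diagonal.\<close>

lemma circle_C1_lipschitz:
  assumes "circle_C1 g g'"
  obtains L where "L \<ge> 0" "\<And>z w. z \<in> circle \<Longrightarrow> w \<in> circle \<Longrightarrow> norm (g z - g w) \<le> L * norm (z - w)"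
proof -
  have c: "continuous_on circle g'"
    and d: "((\<lambda>t. g (cis t)) has_vector_derivative g' (cis t)) (at t)" for t
    using assms by (auto simp: circle_C1_def)
  obtain B where B: "B \<ge> 0" "\<And>z. z \<in> circle \<Longrightarrow> norm (g' z) \<le> B"
    using continuous_circle_bounded[OF c] by metis
  show ?thesis
  proof (rule that[of "B * (pi / 2)"])
    fix z w :: complex assume zw: "z \<in> circle" "w \<in> circle"
    obtain b where b: "w = cis b" using zw circle_cisE by metis
    have "z / w \<in> circle" using zw by (simp add: norm_divide)
    then obtain t where t: "z / w = cis t" "\<bar>t\<bar> \<le> pi" using circle_cisE by metis
    have "z = w * cis t" using t(1) circle_nonzero[OF zw(2)] by (simp add: field_simps)
    then have z: "z = cis (b + t)" by (simp add: b cis_mult)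
    have "norm (g (cis (b + t)) - g (cis b)) \<le> B * norm (b + t - b)"
    proof (rule differentiable_bound[where S = UNIV and f = "\<lambda>t. g (cis t)" and f' = "\<lambda>t x. x *\<^sub>R g' (cis t)"])
      show "((\<lambda>t. g (cis t)) has_derivative (\<lambda>x. x *\<^sub>R g' (cis t))) (at t within UNIV)" for t
        using d by (simp add: has_vector_derivative_def)
      show "onorm (\<lambda>x. x *\<^sub>R g' (cis t)) \<le> B" for t
        by (rule onorm_le) (use B(2)[of "cis t"] in \<open>auto simp: mult_right_mono mult.commute[of "\<bar>_\<bar>"]\<close>)
    qed auto
    also have "norm (b + t - b) \<le> (pi / 2) * norm (cis t - 1)"
      using norm_cis_minus_one_ge[OF t(2)] by (simp add: field_simps)
    also have "norm (cis t - 1) = norm (z - w)"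
    proof -
      have "z - w = w * (cis t - 1)" using \<open>z = w * cis t\<close> by (simp add: algebra_simps)
      then show ?thesis using zw by (simp add: norm_mult)
    qed
    finally show "norm (g z - g w) \<le> B * (pi / 2) * norm (z - w)"
      using B(1) by (simp add: z b mult_left_mono)
  qed (use B in auto)
qed

lemma circle_C1_continuous: "circle_C1 g g' \<Longrightarrow> continuous_on circle g"
proof -
  assume "circle_C1 g g'"
  then obtain L where "L \<ge> 0" "\<And>z w. z \<in> circle \<Longrightarrow> w \<in> circle \<Longrightarrow> norm (g z - g w) \<le> L * norm (z - w)"
    using circle_C1_lipschitz by metis
  then have "L-lipschitz_on circle g" by (intro lipschitz_onI) (auto simp: dist_norm)
  then show ?thesis by (rule lipschitz_on_continuous_on)
qed

section \<open>Fourier series\<close>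

definition fourier :: "(complex \<Rightarrow> complex) \<Rightarrow> int \<Rightarrow> complex" where
  "fourier g k = (LINT z|circle_haar. g z * z powi (- k))"

abbreviation bdd_circle :: "(complex \<Rightarrow> complex) \<Rightarrow> bool" where
  "bdd_circle g \<equiv> (\<exists>B. \<forall>z\<in>circle. norm (g z) \<le> B)"

lemmas haar_measurable = measurable_continuous_circle[OF circle_prob_circle_haar]
lemmas haar_integrable = integrable_continuous_circle[OF circle_prob_circle_haar]

lemma measurable_powi_circle:
  assumes "circle_prob M" shows "(\<lambda>z::complex. z powi k) \<in> borel_measurable M"
  by (rule measurable_continuous_circle[OF assms]) (auto intro!: continuous_intros)

lemma integrable_bdd_circle:
  assumes "circle_prob M" "g \<in> borel_measurable M" "bdd_circle g"
  shows "integrable M g"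
  using assms integrable_bounded_circle by metis

lemma integrable_bdd_powi:
  assumes "circle_prob M" "g \<in> borel_measurable M" "bdd_circle g"
  shows "integrable M (\<lambda>z. g z * z powi k)"
proof (rule integrable_bdd_circle[OF assms(1)])
  show "(\<lambda>z. g z * z powi k) \<in> borel_measurable M"
    using assms(2) measurable_powi_circle[OF assms(1)] by measurable
  show "bdd_circle (\<lambda>z. g z * z powi k)"
    using assms(3) by (simp add: norm_mult norm_power_int)
qed

lemma continuous_bdd_circle: "continuous_on circle g \<Longrightarrow> bdd_circle g"
  using continuous_circle_bounded by metis

lemma integral_circle_cong:
  assumes "circle_prob M" "\<And>z. z \<in> circle \<Longrightarrow> f z = g z"
  shows "(LINT z|M. f z) = (LINT z|M. g z)"
  by (rule Bochner_Integration.integral_cong) (use assms space_circle_prob in auto)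

lemma integral_cnj_circle: "(LINT z|M. cnj (f z)) = cnj (LINT z|M. f z)"
  by simp

lemma borel_measurable_cnj [measurable]:
  assumes "f \<in> borel_measurable M" shows "(\<lambda>x. cnj (f x)) \<in> borel_measurable M"
  by (rule measurable_compose[OF assms]) (auto intro!: borel_measurable_continuous_onI continuous_intros)

text \<open>Expansion of the nonnegative integral of |g - S|^2: both the cross terms and the square
  of the partial sum \<open>S\<close> integrate to the left side. The form for bounded measurable
  \<open>g\<close> serves difference quotients, which may jump at one point.\<close>

lemma bessel:
  assumes m: "g \<in> borel_measurable circle_haar" and b: "bdd_circle g" and F: "finite F"
  shows "(\<Sum>k\<in>F. (cmod (fourier g k))\<^sup>2) \<le> (LINT z|circle_haar. (cmod (g z))\<^sup>2)"
proof -
  note cp = circle_prob_circle_haar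
  define S where "S z = (\<Sum>k\<in>F. fourier g k * z powi k)" for z
  define A where "A = (\<Sum>k\<in>F. (cmod (fourier g k))\<^sup>2)"
  have Sc: "continuous_on circle S"
    unfolding S_def by (auto intro!: continuous_intros)
  have Sm: "S \<in> borel_measurable circle_haar" using haar_measurable[OF Sc] .
  obtain BS where BS: "\<And>z. z \<in> circle \<Longrightarrow> cmod (S z) \<le> BS"
    using continuous_bdd_circle[OF Sc] by blast
  obtain B where B: "\<And>z. z \<in> circle \<Longrightarrow> cmod (g z) \<le> B" using b by blast
  have BB: "B \<ge> 0" "BS \<ge> 0"
    using B[of 1] BS[of 1] norm_ge_zero order_trans by (auto intro: order_trans[OF norm_ge_zero])
  have cS: "z \<in> circle \<Longrightarrow> cnj (S z) = (\<Sum>k\<in>F. cnj (fourier g k) * z powi (- k))" for z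
    unfolding S_def using cnj_powi_circle[of z] by (simp add: power_int_minus flip: complex_cnj_power_int)
  have igS: "integrable circle_haar (\<lambda>z. g z * cnj (S z))"
    by (rule integrable_bounded_circle[OF cp, of _ "B * BS"])
       (use m Sm B BS BB in \<open>auto simp: norm_mult intro!: mult_mono\<close>)
  have iSS: "integrable circle_haar (\<lambda>z. S z * cnj (S z))"
    by (intro haar_integrable continuous_intros Sc)
  have igg: "integrable circle_haar (\<lambda>z. g z * cnj (g z))"
    by (rule integrable_bounded_circle[OF cp, of _ "B * B"])
       (use m B BB in \<open>auto simp: norm_mult intro!: mult_mono\<close>)
  have gS: "(LINT z|circle_haar. g z * cnj (S z)) = of_real A"
  proof -
    have "(LINT z|circle_haar. g z * cnj (S z))
        = (LINT z|circle_haar. (\<Sum>k\<in>F. cnj (fourier g k) * (g z * z powi (- k))))"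
      by (rule integral_circle_cong[OF cp]) (simp add: cS sum_distrib_left mult_ac)
    also have "\<dots> = (\<Sum>k\<in>F. cnj (fourier g k) * fourier g k)"
      using integrable_bdd_powi[OF cp m b] by (subst Bochner_Integration.integral_sum) (auto simp: fourier_def)
    finally show ?thesis by (simp add: A_def complex_norm_square[unfolded of_real_power] mult.commute)
  qed
  have SS: "(LINT z|circle_haar. S z * cnj (S z)) = of_real A"
  proof -
    have "(LINT z|circle_haar. S z * cnj (S z))
        = (LINT z|circle_haar. (\<Sum>j\<in>F. \<Sum>k\<in>F. fourier g j * cnj (fourier g k) * z powi (j - k)))"
    proof (rule integral_circle_cong[OF cp])
      fix z :: complex assume z: "z \<in> circle"
      show "S z * cnj (S z) = (\<Sum>j\<in>F. \<Sum>k\<in>F. fourier g j * cnj (fourier g k) * z powi (j - k))"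
        unfolding cS[OF z] unfolding S_def sum_product
        by (intro sum.cong refl) (use circle_nonzero[OF z] in \<open>simp add: power_int_diff power_int_minus divide_inverse\<close>)
    qed
    also have "\<dots> = (\<Sum>j\<in>F. \<Sum>k\<in>F. fourier g j * cnj (fourier g k) * (LINT z|circle_haar. z powi (j - k)))"
    proof -
      have i: "integrable circle_haar (\<lambda>z. fourier g j * cnj (fourier g k) * z powi (j - k))" for j k
        by (rule haar_integrable) (auto intro!: continuous_intros)
      show ?thesis
        by (subst Bochner_Integration.integral_sum, intro Bochner_Integration.integrable_sum i)
           (subst Bochner_Integration.integral_sum, rule i, simp)
    qed
    also have "\<dots> = (\<Sum>j\<in>F. fourier g j * cnj (fourier g j))"
      using F by (simp add: integral_circle_haar_powi of_bool_def if_distrib[of "\<lambda>x. _ * x"] cong: if_cong)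
    finally show ?thesis by (simp add: A_def complex_norm_square[unfolded of_real_power] mult.commute)
  qed
  have "(LINT z|circle_haar. cnj (g z * cnj (S z))) = of_real A"
    by (subst integral_cnj_circle) (simp only: gS complex_cnj_complex_of_real)
  then have Sg: "(LINT z|circle_haar. S z * cnj (g z)) = of_real A"
    by (simp add: mult.commute)
  have iSg: "integrable circle_haar (\<lambda>z. S z * cnj (g z))"
    using integrable_cnj[OF igS] by (simp add: mult.commute)
  have gg: "(LINT z|circle_haar. g z * cnj (g z)) = of_real (LINT z|circle_haar. (cmod (g z))\<^sup>2)"
    by (subst integral_complex_of_real[symmetric]) (simp only: complex_norm_square)
  have "complex_of_real (LINT z|circle_haar. (cmod (g z - S z))\<^sup>2) = (LINT z|circle_haar. (g z - S z) * cnj (g z - S z))"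
    by (subst integral_complex_of_real[symmetric]) (simp only: complex_norm_square)
  also have "\<dots> = (LINT z|circle_haar. (g z * cnj (g z) - g z * cnj (S z)) - (S z * cnj (g z) - S z * cnj (S z)))"
    by (simp add: algebra_simps)
  also have "\<dots> = of_real ((LINT z|circle_haar. (cmod (g z))\<^sup>2) - A)"
    using igS iSS igg iSg by (simp add: gS SS Sg gg)
  finally have "(LINT z|circle_haar. (cmod (g z - S z))\<^sup>2) = (LINT z|circle_haar. (cmod (g z))\<^sup>2) - A"
    by (simp only: of_real_eq_iff)
  moreover have "0 \<le> (LINT z|circle_haar. (cmod (g z - S z))\<^sup>2)" by simp
  ultimately show ?thesis by (simp add: A_def)
qed

text \<open>Frequencies are paired as n + 1 and -(n + 1), so that a series over all nonzero integers
  becomes a series over \<open>nat\<close>; the coefficient at 0 is always kept apart.\<close>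

abbreviation pos_freq :: "nat \<Rightarrow> int" where "pos_freq n \<equiv> int (Suc n)"
abbreviation neg_freq :: "nat \<Rightarrow> int" where "neg_freq n \<equiv> - int (Suc n)"

lemma bessel_series:
  assumes m: "g \<in> borel_measurable circle_haar" and b: "bdd_circle g"
  shows "summable (\<lambda>n. (cmod (fourier g (pos_freq n)))\<^sup>2 + (cmod (fourier g (neg_freq n)))\<^sup>2)"
    and "(\<Sum>n. (cmod (fourier g (pos_freq n)))\<^sup>2 + (cmod (fourier g (neg_freq n)))\<^sup>2)
      \<le> (LINT z|circle_haar. (cmod (g z))\<^sup>2)"
proof -
  let ?a = "\<lambda>n. (cmod (fourier g (pos_freq n)))\<^sup>2 + (cmod (fourier g (neg_freq n)))\<^sup>2"
  have le: "(\<Sum>n<N. ?a n) \<le> (LINT z|circle_haar. (cmod (g z))\<^sup>2)" for N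
  proof -
    have "(\<Sum>n<N. ?a n) = (\<Sum>k\<in>pos_freq ` {..<N}. (cmod (fourier g k))\<^sup>2) + (\<Sum>k\<in>neg_freq ` {..<N}. (cmod (fourier g k))\<^sup>2)"
      by (simp add: sum.distrib sum.reindex inj_on_def)
    also have "\<dots> = (\<Sum>k\<in>pos_freq ` {..<N} \<union> neg_freq ` {..<N}. (cmod (fourier g k))\<^sup>2)"
      by (rule sum.union_disjoint[symmetric]) auto
    also have "\<dots> \<le> (LINT z|circle_haar. (cmod (g z))\<^sup>2)"
      by (rule bessel[OF m b]) auto
    finally show ?thesis .
  qed
  show s: "summable ?a"
    by (rule summableI_nonneg_bounded[OF _ le]) auto
  show "suminf ?a \<le> (LINT z|circle_haar. (cmod (g z))\<^sup>2)"
    by (rule suminf_le_const[OF s le])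
qed

text \<open>The Riemann-Lebesgue lemma for bounded functions: the terms of the convergent Bessel
  series tend to 0.\<close>

lemma fourier_tendsto_0:
  assumes "g \<in> borel_measurable circle_haar" "bdd_circle g"
  shows "(\<lambda>n. fourier g (pos_freq n)) \<longlonglongrightarrow> 0" "(\<lambda>n. fourier g (neg_freq n)) \<longlonglongrightarrow> 0"
proof -
  have *: "(\<lambda>n. (cmod (fourier g (pos_freq n)))\<^sup>2 + (cmod (fourier g (neg_freq n)))\<^sup>2) \<longlonglongrightarrow> 0"
    using bessel_series(1)[OF assms] by (rule summable_LIMSEQ_zero)
  have "(\<lambda>n. (cmod (fourier g (pos_freq n)))\<^sup>2) \<longlonglongrightarrow> 0" "(\<lambda>n. (cmod (fourier g (neg_freq n)))\<^sup>2) \<longlonglongrightarrow> 0"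
    by (rule tendsto_sandwich[OF _ _ tendsto_const *]; simp)+
  then show "(\<lambda>n. fourier g (pos_freq n)) \<longlonglongrightarrow> 0" "(\<lambda>n. fourier g (neg_freq n)) \<longlonglongrightarrow> 0"
    by (auto simp: tendsto_norm_zero_iff dest!: power_tendsto_0_iff[THEN iffD1, rotated])
qed

section \<open>Fourier series of C^1 functions\<close>

lemma circle_C1_mult_powi:
  assumes "circle_C1 g g'"
  shows "circle_C1 (\<lambda>z. g z * z powi k) (\<lambda>z. g' z * z powi k + \<i> * of_int k * (g z * z powi k))"
  unfolding circle_C1_def
proof (intro conjI allI)
  have gc: "continuous_on circle g" "continuous_on circle g'"
    using assms circle_C1_continuous by (auto simp: circle_C1_def)
  show "continuous_on circle (\<lambda>z. g' z * z powi k + \<i> * of_int k * (g z * z powi k))"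
    using gc by (auto intro!: continuous_intros)
  fix t
  have d: "((\<lambda>t. g (cis t)) has_vector_derivative g' (cis t)) (at t)"
    using assms by (auto simp: circle_C1_def)
  have "((\<lambda>t. g (cis t) * cis (of_int k * t)) has_vector_derivative
      (g (cis t) * (\<i> * of_int k * cis (of_int k * t)) + g' (cis t) * cis (of_int k * t))) (at t)"
  proof (rule has_vector_derivative_mult[OF d])
    have "((\<lambda>z. exp (\<i> * of_int k * z)) has_field_derivative \<i> * of_int k * exp (\<i> * of_int k * of_real t)) (at (of_real t))"
      by (auto intro!: derivative_eq_intros)
    from has_vector_derivative_real_field[OF this]
    show "((\<lambda>t. cis (of_int k * t)) has_vector_derivative \<i> * of_int k * cis (of_int k * t)) (at t)"
      by (simp add: cis_conv_exp mult.assoc)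
  qed
  then show "((\<lambda>t. g (cis t) * cis t powi k) has_vector_derivative
        g' (cis t) * cis t powi k + \<i> * of_int k * (g (cis t) * cis t powi k)) (at t)"
    by (simp add: cis_power_int algebra_simps)
qed

text \<open>Integration by parts: the derivative of \<open>g z * z powi (- k)\<close> integrates to
  0 over the circle.\<close>

lemma fourier_deriv:
  assumes "circle_C1 g g'"
  shows "fourier g' k = \<i> * of_int k * fourier g k"
proof -
  have gc: "continuous_on circle g" "continuous_on circle g'"
    using assms circle_C1_continuous by (auto simp: circle_C1_def)
  have i: "integrable circle_haar (\<lambda>z. g z * z powi (- k))" "integrable circle_haar (\<lambda>z. g' z * z powi (- k))"
    by (rule haar_integrable; use gc in \<open>auto intro!: continuous_intros\<close>)+
  have "0 = (LINT z|circle_haar. g' z * z powi (- k) + \<i> * of_int (- k) * (g z * z powi (- k)))"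
    by (rule integral_circle_haar_deriv[OF circle_C1_mult_powi[OF assms], symmetric])
  also have "\<dots> = fourier g' k + \<i> * of_int (- k) * fourier g k"
    unfolding fourier_def using i by (subst Bochner_Integration.integral_add) auto
  finally show ?thesis by simp
qed

text \<open>Up to a factor of modulus 1, a coefficient of \<open>g\<close> is that of
  \<open>g'\<close> divided by the frequency, hence a product of two square-summable sequences. The
  square of a difference in \<open>*\<close> bounds it by the sum of their squares.\<close>

lemma summable_fourier:
  assumes "circle_C1 g g'"
  shows "summable (\<lambda>n. cmod (fourier g (pos_freq n)) + cmod (fourier g (neg_freq n)))"
proof (rule summable_comparison_test')
  have gc: "continuous_on circle g'" using assms by (auto simp: circle_C1_def)
  let ?a = "\<lambda>n. (cmod (fourier g' (pos_freq n)))\<^sup>2 + (cmod (fourier g' (neg_freq n)))\<^sup>2"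
  have "summable (\<lambda>n. 1 / real (Suc n) ^ 2)"
    using inverse_power_summable[of 2, where 'a = real] summable_Suc_iff[of "\<lambda>n. 1 / real n ^ 2"]
    by (simp add: inverse_eq_divide)
  then show "summable (\<lambda>n. 1 / real (Suc n) ^ 2 + ?a n)"
    by (rule summable_add[OF _ bessel_series(1)[OF haar_measurable[OF gc] continuous_bdd_circle[OF gc]]])
  fix n :: nat
  have *: "2 * x \<le> 1 / real (Suc n) ^ 2 + (real (Suc n) * x)\<^sup>2" for x
  proof -
    have "0 \<le> (1 / real (Suc n) - real (Suc n) * x)\<^sup>2" by simp
    also have "\<dots> = 1 / real (Suc n) ^ 2 + (real (Suc n) * x)\<^sup>2 - 2 * x"
      by (simp add: power2_diff power_divide del: of_nat_Suc)
    finally show ?thesis by simp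
  qed
  have "cmod (fourier g' (pos_freq n)) = real (Suc n) * cmod (fourier g (pos_freq n))"
    "cmod (fourier g' (neg_freq n)) = real (Suc n) * cmod (fourier g (neg_freq n))"
    by (simp_all add: fourier_deriv[OF assms] norm_mult del: of_nat_Suc)
  then show "norm (cmod (fourier g (pos_freq n)) + cmod (fourier g (neg_freq n))) \<le> 1 / real (Suc n) ^ 2 + ?a n"
    using *[of "cmod (fourier g (pos_freq n))"] *[of "cmod (fourier g (neg_freq n))"]
      zero_le_power2[of "real (Suc n) * cmod (fourier g (pos_freq n))"]
      zero_le_power2[of "real (Suc n) * cmod (fourier g (neg_freq n))"]
      norm_ge_zero[of "fourier g (pos_freq n)"] norm_ge_zero[of "fourier g (neg_freq n)"]
    unfolding real_norm_def by (simp only: abs_of_nonneg add_nonneg_nonneg)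
qed

text \<open>With \<open>h w = (g w - g z0) / (w - z0)\<close> the coefficients of \<open>g - g z0 = (w - z0) h\<close>
  telescope, so that the partial sums at \<open>z0\<close> converge by the Riemann-Lebesgue lemma for \<open>h\<close>.\<close>

lemma fourier_series:
  assumes g: "circle_C1 g g'" and z0: "z0 \<in> circle"
  shows "(\<lambda>n. fourier g (pos_freq n) * z0 powi (pos_freq n) + fourier g (neg_freq n) * z0 powi (neg_freq n))
    sums (g z0 - fourier g 0)"
proof -
  note cp = circle_prob_circle_haar
  have gc: "continuous_on circle g" using circle_C1_continuous[OF g] .
  obtain L where L: "L \<ge> 0" "\<And>z w. z \<in> circle \<Longrightarrow> w \<in> circle \<Longrightarrow> norm (g z - g w) \<le> L * norm (z - w)"
    using circle_C1_lipschitz[OF g] by metis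
  define h where "h w = (g w - g z0) / (w - z0)" for w
  have hm: "h \<in> borel_measurable circle_haar"
    unfolding h_def using haar_measurable[OF gc] haar_measurable[OF continuous_on_id] by measurable
  have hb: "bdd_circle h"
  proof (intro exI ballI)
    fix w :: complex assume w: "w \<in> circle"
    show "norm (h w) \<le> L"
      using L(1) L(2)[OF w z0] by (cases "w = z0") (auto simp: h_def norm_divide divide_simps)
  qed
  \<comment> \<open>At \<open>w = z0\<close> division by zero makes \<open>h\<close> vanish, and the
    identity still holds there.\<close>
  have gh: "g w = g z0 + (h w * w - z0 * h w)" for w
  proof -
    have "(w - z0) * h w = g w - g z0" by (simp add: h_def)
    then show ?thesis by (simp add: algebra_simps)
  qed
  have coef: "fourier g k = of_bool (k = 0) * g z0 + fourier h (k - 1) - z0 * fourier h k" for k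
  proof -
    have "fourier g k = (LINT z|circle_haar. g z0 * z powi (- k) + (h z * z powi (- (k - 1)) - z0 * (h z * z powi (- k))))"
      unfolding fourier_def
    proof (rule integral_circle_cong[OF cp])
      fix z :: complex assume z: "z \<in> circle"
      have "z powi (- (k - 1)) = z powi (- k) * z"
        using power_int_add_1[of z "-k"] circle_nonzero[OF z] by simp
      then show "g z * z powi - k = g z0 * z powi - k + (h z * z powi - (k - 1) - z0 * (h z * z powi - k))"
        by (subst gh) (simp add: algebra_simps)
    qed
    also have "\<dots> = g z0 * (LINT z|circle_haar. z powi (- k)) + (fourier h (k - 1) - z0 * fourier h k)"
      unfolding fourier_def using integrable_bdd_powi[OF cp hm hb] haar_integrable
      by (subst Bochner_Integration.integral_add)
         (auto intro!: continuous_intros haar_integrable simp del: minus_diff_eq)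
    finally show ?thesis by (simp add: integral_circle_haar_powi)
  qed
  \<comment> \<open>\<open>T\<close> absorbs the two \<open>h\<close>-terms of \<open>coef\<close>,
    so that multiplication by \<open>z0 powi k\<close> leaves the telescoping difference
    \<open>T k - T (k + 1)\<close>.\<close>
  define T where "T k = z0 powi k * fourier h (k - 1)" for k
  have coefT: "fourier g k * z0 powi k = of_bool (k = 0) * g z0 + T k - T (k + 1)" for k
    using power_int_add_1[of z0 k] circle_nonzero[OF z0]
    by (simp add: coef T_def algebra_simps of_bool_def)
  have psum: "(\<Sum>n<N. fourier g (pos_freq n) * z0 powi (pos_freq n) + fourier g (neg_freq n) * z0 powi (neg_freq n))
     = g z0 - fourier g 0 + T (- int N) - T (int (Suc N))" for N
  proof (induction N)
    case 0
    show ?case using coefT[of 0] by simp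
  next
    case (Suc N)
    have "fourier g (pos_freq N) * z0 powi (pos_freq N) = T (int (Suc N)) - T (int (Suc (Suc N)))"
      "fourier g (neg_freq N) * z0 powi (neg_freq N) = T (- int (Suc N)) - T (- int N)"
      unfolding coefT by (simp_all add: algebra_simps)
    then show ?case unfolding sum.lessThan_Suc Suc.IH by simp
  qed
  have nT: "norm (T k) = norm (fourier h (k - 1))" for k
    using z0 by (simp add: T_def norm_mult norm_power_int)
  \<comment> \<open>\<open>T (- n)\<close> involves the coefficient of \<open>h\<close> at -(n + 1),
    but \<open>T (n + 1)\<close> the one at n, which is a \<open>pos_freq\<close> only after a
    further shift by one.\<close>
  have "- int n - 1 = neg_freq n" "int (Suc (Suc n)) - 1 = pos_freq n" for n by auto
  then have "(\<lambda>n. T (- int n)) \<longlonglongrightarrow> 0" "(\<lambda>n. T (int (Suc (Suc n)))) \<longlonglongrightarrow> 0"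
    using fourier_tendsto_0[OF hm hb] by (subst tendsto_norm_zero_iff[symmetric]; simp only: nT tendsto_norm_zero_iff)+
  then have "(\<lambda>n. T (- int n)) \<longlonglongrightarrow> 0" "(\<lambda>n. T (int (Suc n))) \<longlonglongrightarrow> 0"
    by (simp_all only: filterlim_sequentially_Suc[of "\<lambda>n. T (int (Suc n))"])
  then have "(\<lambda>N. g z0 - fourier g 0 + T (- int N) - T (int (Suc N))) \<longlonglongrightarrow> g z0 - fourier g 0 + 0 - 0"
    by (intro tendsto_intros)
  then show ?thesis unfolding sums_def psum by simp
qed

text \<open>Absolute summability of the coefficients allows integration term by term, for every
  measure and every bounded weight. The weight \<open>cnj (g z)\<close> with Haar measure gives
  Parseval's identity; the weight 1 with an arbitrary \<open>M\<close> expresses integrals through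
  moments.\<close>

lemma fourier_series_integral:
  assumes M: "circle_prob M" and g: "circle_C1 g g'"
    and b: "b \<in> borel_measurable M" "bdd_circle b"
  shows "(\<lambda>n. fourier g (pos_freq n) * (LINT z|M. b z * z powi (pos_freq n))
            + fourier g (neg_freq n) * (LINT z|M. b z * z powi (neg_freq n)))
    sums ((LINT z|M. b z * g z) - fourier g 0 * (LINT z|M. b z))"
proof -
  interpret prob_space M using M by (rule circle_prob_prob_space)
  let ?c = "\<lambda>n. cmod (fourier g (pos_freq n)) + cmod (fourier g (neg_freq n))"
  let ?f = "\<lambda>n z. fourier g (pos_freq n) * (b z * z powi (pos_freq n)) + fourier g (neg_freq n) * (b z * z powi (neg_freq n))"
  obtain B where B: "\<And>z. z \<in> circle \<Longrightarrow> norm (b z) \<le> B" using b(2) by blast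
  have B0: "B \<ge> 0" using B[of 1] by (auto intro: order_trans[OF norm_ge_zero])
  have s: "summable (\<lambda>n. ?c n * B)" using summable_fourier[OF g] by (rule summable_mult2)
  have i: "integrable M (?f n)" for n
    using integrable_bdd_powi[OF M b] by auto
  have bd: "norm (?f n z) \<le> ?c n * B" if z: "z \<in> circle" for n z
  proof -
    have "norm (?f n z) \<le> cmod (fourier g (pos_freq n)) * cmod (b z) + cmod (fourier g (neg_freq n)) * cmod (b z)"
      using z by (intro norm_triangle_le) (simp add: norm_mult norm_power_int)
    also have "\<dots> = ?c n * cmod (b z)" by (simp add: algebra_simps)
    also have "\<dots> \<le> ?c n * B" by (intro mult_left_mono B z) auto
    finally show ?thesis .
  qed
  have "(\<lambda>n. LINT z|M. ?f n z) sums (LINT z|M. (\<Sum>n. ?f n z))"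
  proof (rule sums_integral[OF i])
    show "AE z in M. summable (\<lambda>n. norm (?f n z))"
      by (rule AE_I2, rule summable_comparison_test'[OF s]) (use bd space_circle_prob[OF M] in auto)
    show "summable (\<lambda>n. LINT z|M. norm (?f n z))"
    proof (rule summable_comparison_test'[OF s])
      fix n
      have "(LINT z|M. norm (?f n z)) \<le> (LINT z|M. ?c n * B)"
        using bd space_circle_prob[OF M] by (intro integral_mono integrable_norm i) auto
      then show "norm (LINT z|M. norm (?f n z)) \<le> ?c n * B" by (simp add: prob_space)
    qed
  qed
  also have "(LINT z|M. (\<Sum>n. ?f n z)) = (LINT z|M. b z * g z - fourier g 0 * b z)"
  proof (rule integral_circle_cong[OF M])
    fix z :: complex assume "z \<in> circle"
    from sums_mult[OF fourier_series[OF g this], of "b z"]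
    show "(\<Sum>n. ?f n z) = b z * g z - fourier g 0 * b z"
      by (intro sums_unique[symmetric]) (simp add: algebra_simps del: of_nat_Suc)
  qed
  also have "\<dots> = (LINT z|M. b z * g z) - fourier g 0 * (LINT z|M. b z)"
  proof -
    obtain G where G: "G \<ge> 0" "\<And>z. z \<in> circle \<Longrightarrow> norm (g z) \<le> G"
      using continuous_circle_bounded[OF circle_C1_continuous[OF g]] by metis
    have "integrable M (\<lambda>z. b z * g z)"
      by (rule integrable_bounded_circle[OF M, of _ "B * G"])
         (use b(1) measurable_continuous_circle[OF M circle_C1_continuous[OF g]] B G B0 in
           \<open>auto simp: norm_mult intro!: mult_mono\<close>)
    then show ?thesis using integrable_bdd_circle[OF M b] by simp
  qed
  finally show ?thesis
    by (simp only: Bochner_Integration.integral_add[OF integrable_mult_right[OF integrable_bdd_powi[OF M b]]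
          integrable_mult_right[OF integrable_bdd_powi[OF M b]]] integral_mult_right_zero)
qed

lemma fourier_cnj: "(LINT z|circle_haar. cnj (g z) * z powi k) = cnj (fourier g k)"
proof -
  have "(LINT z|circle_haar. cnj (g z) * z powi k) = (LINT z|circle_haar. cnj (g z * z powi (- k)))"
    by (rule integral_circle_cong[OF circle_prob_circle_haar])
       (simp only: complex_cnj_mult cnj_powi_circle minus_minus)
  also have "\<dots> = cnj (fourier g k)"
    unfolding fourier_def by (rule integral_cnj_circle)
  finally show ?thesis .
qed

lemma parseval:
  assumes g: "circle_C1 g g'"
  shows "(\<lambda>n. (cmod (fourier g (pos_freq n)))\<^sup>2 + (cmod (fourier g (neg_freq n)))\<^sup>2)
    sums ((LINT z|circle_haar. (cmod (g z))\<^sup>2) - (cmod (fourier g 0))\<^sup>2)"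
proof -
  have gc: "continuous_on circle g" using circle_C1_continuous[OF g] .
  have "continuous_on circle (\<lambda>z. cnj (g z))" using gc by (intro continuous_intros)
  from fourier_series_integral[OF circle_prob_circle_haar g haar_measurable[OF this] continuous_bdd_circle[OF this]]
  have "(\<lambda>n. fourier g (pos_freq n) * cnj (fourier g (pos_freq n)) + fourier g (neg_freq n) * cnj (fourier g (neg_freq n)))
    sums ((LINT z|circle_haar. cnj (g z) * g z) - fourier g 0 * cnj (fourier g 0))"
    unfolding fourier_cnj using fourier_cnj[of g 0] by simp
  moreover have "(LINT z|circle_haar. cnj (g z) * g z) = of_real (LINT z|circle_haar. (cmod (g z))\<^sup>2)"
    by (subst integral_complex_of_real[symmetric]) (simp only: complex_norm_square mult.commute)
  ultimately have "(\<lambda>n. complex_of_real ((cmod (fourier g (pos_freq n)))\<^sup>2 + (cmod (fourier g (neg_freq n)))\<^sup>2))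
    sums (complex_of_real ((LINT z|circle_haar. (cmod (g z))\<^sup>2) - (cmod (fourier g 0))\<^sup>2))"
    by (simp only: complex_norm_square[symmetric] of_real_add of_real_diff)
  then show ?thesis by (simp only: sums_of_real_iff)
qed


section \<open>The Dirichlet form\<close>

lemma circle_C1_rotate_diff:
  assumes g: "circle_C1 g g'" and u: "u \<in> circle"
  shows "circle_C1 (\<lambda>z. g (u * z) - g z) (\<lambda>z. g' (u * z) - g' z)"
  unfolding circle_C1_def
proof (intro conjI allI)
  have c: "continuous_on circle g'"
    and d: "((\<lambda>t. g (cis t)) has_vector_derivative g' (cis t)) (at t)" for t
    using g by (auto simp: circle_C1_def)
  have "continuous_on circle (\<lambda>z. g' (u * z))"
    by (rule continuous_on_compose2[OF c]) (use u in \<open>auto intro!: continuous_intros simp: norm_mult\<close>)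
  then show "continuous_on circle (\<lambda>z. g' (u * z) - g' z)"
    using c by (intro continuous_intros)
  fix t
  obtain b where b: "u = cis b" using u circle_cisE by metis
  have "((\<lambda>t. b + t) has_vector_derivative 1) (at t)"
    by (auto intro!: derivative_eq_intros)
  from vector_diff_chain_at[OF this d]
  have "((\<lambda>t. g (u * cis t)) has_vector_derivative g' (u * cis t)) (at t)"
    by (simp add: o_def b cis_mult)
  then show "((\<lambda>t. g (u * cis t) - g (cis t)) has_vector_derivative g' (u * cis t) - g' (cis t)) (at t)"
    by (intro has_vector_derivative_diff d)
qed

lemma continuous_rotate:
  assumes "continuous_on circle g" "u \<in> circle"
  shows "continuous_on circle (\<lambda>z. g (u * z))"
  by (rule continuous_on_compose2[OF assms(1)])
     (use assms(2) in \<open>auto intro!: continuous_intros simp: norm_mult\<close>)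

lemma fourier_rotate_diff:
  assumes g: "continuous_on circle g" and u: "u \<in> circle"
  shows "fourier (\<lambda>z. g (u * z) - g z) k = (u powi k - 1) * fourier g k"
proof -
  note cp = circle_prob_circle_haar
  have c: "continuous_on circle (\<lambda>z. g z * z powi (- k))"
    using g by (auto intro!: continuous_intros)
  have c': "continuous_on circle (\<lambda>z. g (u * z) * z powi (- k))"
    using continuous_rotate[OF g u] by (auto intro!: continuous_intros)
  have "(LINT z|circle_haar. g (u * z) * z powi (- k))
      = (LINT z|circle_haar. u powi k * (g (u * z) * (u * z) powi (- k)))"
    by (rule integral_circle_cong[OF cp])
       (use circle_nonzero[OF u] in \<open>simp add: power_int_mult_distrib power_int_minus field_simps\<close>)
  also have "\<dots> = u powi k * (LINT z|circle_haar. g z * z powi (- k))"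
    using integral_circle_haar_rotate[OF haar_measurable[OF c] u] by simp
  finally show ?thesis
    unfolding fourier_def using haar_integrable[OF c] haar_integrable[OF c']
    by (simp add: left_diff_distrib)
qed

text \<open>Negative exponents reduce to positive ones because dividing by a power of
  \<open>u\<close> does not change the modulus.\<close>

lemma norm_powi_minus_one_le:
  fixes u :: complex assumes "u \<in> circle"
  shows "norm (u powi k - 1) \<le> \<bar>of_int k\<bar> * norm (u - 1)"
proof -
  have nat: "norm (u ^ n - 1) \<le> real n * norm (u - 1)" for n
    using norm_power_diff[of u 1 n] assms by simp
  show ?thesis
  proof (cases k)
    case (nonneg n)
    then show ?thesis using nat[of n] by simp
  next
    case (neg n)
    have "u powi k - 1 = (1 - u ^ Suc n) / u ^ Suc n"
      using circle_nonzero[OF assms] by (simp add: neg power_int_minus field_simps del: power_Suc of_nat_Suc)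
    then have "norm (u powi k - 1) = norm (u ^ Suc n - 1)"
      using assms by (simp add: norm_divide norm_power norm_minus_commute norm_mult)
    moreover have "\<bar>real_of_int k\<bar> = real (Suc n)" by (simp add: neg)
    ultimately show ?thesis using nat[of "Suc n"] by (simp only:)
  qed
qed

text \<open>The constant \<open>c\<close> changes only the coefficient of \<open>g'\<close> at
  frequency 0, where the coefficient of the rotated difference is 0 anyway. Parseval's identity is
  applied to \<open>D\<close>, which is C^1; for \<open>b\<close>, known to be continuous, Bessel's
  inequality points in the right direction.\<close>

lemma rotate_diff_le:
  assumes g: "circle_C1 g g'" and u: "u \<in> circle"
  shows "(LINT z|circle_haar. (cmod (g (u * z) - g z))\<^sup>2)
    \<le> (cmod (u - 1))\<^sup>2 * (LINT z|circle_haar. (cmod (g' z - c))\<^sup>2)"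
proof -
  have gc: "continuous_on circle g" "continuous_on circle g'"
    using g circle_C1_continuous by (auto simp: circle_C1_def)
  define D where "D z = g (u * z) - g z" for z
  have D: "circle_C1 D (\<lambda>z. g' (u * z) - g' z)"
    unfolding D_def by (rule circle_C1_rotate_diff[OF g u])
  have fD: "fourier D k = (u powi k - 1) * fourier g k" for k
    unfolding D_def by (rule fourier_rotate_diff[OF gc(1) u])
  define b where "b z = g' z - c" for z
  have bc: "continuous_on circle b" unfolding b_def using gc by (intro continuous_intros)
  have fb: "fourier b k = \<i> * of_int k * fourier g k" if "k \<noteq> 0" for k
  proof -
    have "integrable circle_haar (\<lambda>z. g' z * z powi (- k))" "integrable circle_haar (\<lambda>z. z powi (- k))"
      using gc by (auto intro!: haar_integrable continuous_intros)
    then have "fourier b k = fourier g' k - c * (LINT z|circle_haar. z powi (- k))"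
      unfolding b_def fourier_def by (simp add: left_diff_distrib)
    then show ?thesis using that by (simp add: integral_circle_haar_powi fourier_deriv[OF g])
  qed
  have le: "(cmod (fourier D k))\<^sup>2 \<le> (cmod (u - 1))\<^sup>2 * (cmod (fourier b k))\<^sup>2" if "k \<noteq> 0" for k
  proof -
    have "cmod (fourier D k) \<le> \<bar>of_int k\<bar> * norm (u - 1) * cmod (fourier g k)"
      unfolding fD norm_mult by (intro mult_right_mono norm_powi_minus_one_le u) auto
    also have "\<dots> = cmod (u - 1) * cmod (fourier b k)"
      using that by (simp add: fb norm_mult)
    finally show ?thesis
      by (metis norm_ge_zero power_mono power_mult_distrib)
  qed
  note sb = bessel_series[OF haar_measurable[OF bc] continuous_bdd_circle[OF bc]]
  have "(LINT z|circle_haar. (cmod (D z))\<^sup>2)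
     = (\<Sum>n. (cmod (fourier D (pos_freq n)))\<^sup>2 + (cmod (fourier D (neg_freq n)))\<^sup>2)"
    using sums_unique[OF parseval[OF D]] by (simp add: fD[of 0])
  also have "\<dots> \<le> (\<Sum>n. (cmod (u - 1))\<^sup>2 * ((cmod (fourier b (pos_freq n)))\<^sup>2 + (cmod (fourier b (neg_freq n)))\<^sup>2))"
  proof (rule suminf_le)
    fix n
    show "(cmod (fourier D (pos_freq n)))\<^sup>2 + (cmod (fourier D (neg_freq n)))\<^sup>2
      \<le> (cmod (u - 1))\<^sup>2 * ((cmod (fourier b (pos_freq n)))\<^sup>2 + (cmod (fourier b (neg_freq n)))\<^sup>2)"
      unfolding distrib_left by (intro add_mono le) auto
  qed (use parseval[OF D] sb(1) in \<open>auto intro!: summable_mult simp: sums_iff simp del: of_nat_Suc\<close>)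
  also have "\<dots> = (cmod (u - 1))\<^sup>2 * (\<Sum>n. (cmod (fourier b (pos_freq n)))\<^sup>2 + (cmod (fourier b (neg_freq n)))\<^sup>2)"
    by (rule suminf_mult[OF sb(1)])
  also have "\<dots> \<le> (cmod (u - 1))\<^sup>2 * (LINT z|circle_haar. (cmod (b z))\<^sup>2)"
    by (intro mult_left_mono sb(2)) auto
  finally show ?thesis by (simp add: D_def b_def)
qed

lemma measurable_circle_fst_snd:
  assumes "circle_prob M"
  shows "(\<lambda>p::complex\<times>complex. fst p) \<in> borel_measurable (M \<Otimes>\<^sub>M M)"
    "(\<lambda>p::complex\<times>complex. snd p) \<in> borel_measurable (M \<Otimes>\<^sub>M M)"
  using measurable_continuous_circle[OF assms continuous_on_id]
  by (auto intro: measurable_compose[OF measurable_fst] measurable_compose[OF measurable_snd])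

text \<open>The substitution w = u z, allowed by rotation invariance, turns the denominator into |u
  - 1|, which is independent of z. After Fubini the bound for a fixed rotation applies, and
  averaging over u preserves it.\<close>

lemma dirichlet_le:
  assumes g: "circle_C1 g g'"
  shows "(LINT z|circle_haar. LINT w|circle_haar. (cmod ((g z - g w) / (z - w)))\<^sup>2)
    \<le> (LINT z|circle_haar. (cmod (g' z - c))\<^sup>2)" (is "_ \<le> ?C")
proof -
  note cp = circle_prob_circle_haar
  note sp = space_circle_prob[OF cp]
  interpret prob_space circle_haar using cp by (rule circle_prob_prob_space)
  interpret P: pair_prob_space circle_haar circle_haar ..
  have gc: "continuous_on circle g" using circle_C1_continuous[OF g] .
  obtain L where L: "L \<ge> 0" "\<And>z w. z \<in> circle \<Longrightarrow> w \<in> circle \<Longrightarrow> norm (g z - g w) \<le> L * norm (z - w)"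
    using circle_C1_lipschitz[OF g] by metis
  define G where "G z u = (cmod ((g (u * z) - g z) / (u - 1)))\<^sup>2" for z u
  have id: "(\<lambda>z::complex. z) \<in> borel_measurable circle_haar"
    by (rule haar_measurable) auto
  have inner: "(LINT w|circle_haar. (cmod ((g z - g w) / (z - w)))\<^sup>2) = (LINT u|circle_haar. G z u)"
    if z: "z \<in> circle" for z
  proof -
    have "(\<lambda>w. (cmod ((g z - g w) / (z - w)))\<^sup>2) \<in> borel_measurable circle_haar"
      using haar_measurable[OF gc] id by measurable
    from integral_circle_haar_rotate[OF this z]
    have "(LINT w|circle_haar. (cmod ((g z - g w) / (z - w)))\<^sup>2)
      = (LINT u|circle_haar. (cmod ((g z - g (z * u)) / (z - z * u)))\<^sup>2)" by simp
    also have "\<dots> = (LINT u|circle_haar. G z u)"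
    proof (rule integral_circle_cong[OF cp])
      fix u :: complex
      have "cmod (z - z * u) = cmod (z * (1 - u))" by (simp add: algebra_simps)
      also have "\<dots> = cmod (u - 1)" using z by (simp add: norm_mult norm_minus_commute)
      finally show "(cmod ((g z - g (z * u)) / (z - z * u)))\<^sup>2 = G z u"
        unfolding G_def norm_divide by (simp add: norm_minus_commute mult.commute)
    qed
    finally show ?thesis .
  qed
  have "(\<lambda>p. snd p * fst p) \<in> circle_haar \<Otimes>\<^sub>M circle_haar \<rightarrow>\<^sub>M circle_haar"
  proof -
    have "(\<lambda>p. snd p * fst p) \<in> circle_haar \<Otimes>\<^sub>M circle_haar \<rightarrow>\<^sub>M circle_borel"
      by (rule measurable_restrict_space2)
         (use measurable_circle_fst_snd[OF cp] in \<open>auto simp: space_pair_measure sp norm_mult\<close>)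
    then show ?thesis
      using measurable_cong_sets[OF refl circle_prob_sets[OF cp]] by blast
  qed
  from measurable_compose[OF this haar_measurable[OF gc]]
  have gm: "(\<lambda>p. g (snd p * fst p)) \<in> borel_measurable (circle_haar \<Otimes>\<^sub>M circle_haar)" .
  have gm1: "(\<lambda>p. g (fst p)) \<in> borel_measurable (circle_haar \<Otimes>\<^sub>M circle_haar)"
    by (rule measurable_compose[OF measurable_fst haar_measurable[OF gc]])
  have Gm: "case_prod G \<in> borel_measurable (circle_haar \<Otimes>\<^sub>M circle_haar)"
    unfolding G_def case_prod_beta using gm gm1 measurable_circle_fst_snd[OF cp] by measurable
  have Gb: "G z u \<le> L\<^sup>2" if "z \<in> circle" "u \<in> circle" for z u
  proof -
    have uz: "u * z \<in> circle" using that by (simp add: norm_mult)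
    have "cmod (u * z - z) = cmod ((u - 1) * z)" by (simp add: algebra_simps)
    then have "cmod (g (u * z) - g z) \<le> L * cmod (u - 1)"
      using L(2)[OF uz that(1)] that by (simp add: norm_mult)
    then have "cmod ((g (u * z) - g z) / (u - 1)) \<le> L"
      using L(1) by (cases "u = 1") (auto simp: norm_divide divide_simps)
    then show ?thesis unfolding G_def by (intro power_mono) auto
  qed
  have Gi: "integrable (circle_haar \<Otimes>\<^sub>M circle_haar) (case_prod G)"
    by (rule P.integrable_const_bound[of _ "L\<^sup>2"])
       (use Gm Gb in \<open>auto simp: space_pair_measure sp G_def\<close>)
  have "(LINT z|circle_haar. LINT w|circle_haar. (cmod ((g z - g w) / (z - w)))\<^sup>2)
    = (LINT z|circle_haar. LINT u|circle_haar. G z u)"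
    by (rule integral_circle_cong[OF cp]) (rule inner)
  also have "\<dots> = (LINT u|circle_haar. LINT z|circle_haar. G z u)"
    by (rule P.Fubini_integral[symmetric, OF Gi])
  also have "\<dots> \<le> ?C"
  proof (rule integral_le_const[OF P.integrable_snd[OF Gi]], rule AE_I2)
    fix u assume "u \<in> space circle_haar"
    then have u: "u \<in> circle" by (simp add: sp)
    have "(LINT z|circle_haar. G z u) = (LINT z|circle_haar. (cmod (g (u * z) - g z))\<^sup>2) / (cmod (u - 1))\<^sup>2"
      unfolding G_def norm_divide power_divide by simp
    also have "\<dots> \<le> ?C"
    \<comment> \<open>At \<open>u = 1\<close> division by zero makes the left side 0.\<close>
    proof (cases "u = 1")
      case False
      then show ?thesis
        using rotate_diff_le[OF g u, of c] by (simp add: divide_simps mult.commute)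
    qed simp
    finally show "(LINT z|circle_haar. G z u) \<le> ?C" .
  qed
  finally show ?thesis .
qed

section \<open>Radial truncation of the logarithmic kernel\<close>

text \<open>The truncation of \<open>- ln |x - y|\<close> obtained by moving \<open>y\<close> to the inside of the disc.\<close>

definition log_kernel :: "real \<Rightarrow> complex \<Rightarrow> complex \<Rightarrow> real" where
  "log_kernel s x y = - ln (cmod (1 - of_real s * (x * cnj y)))"

lemma norm_one_minus_ge:
  assumes "0 \<le> s" "s < 1" "x \<in> circle" "y \<in> circle"
  shows "1 - s \<le> cmod (1 - of_real s * (x * cnj y))"
    and "cmod (1 - of_real s * (x * cnj y)) \<le> 2"
proof -
  have n: "cmod (of_real s * (x * cnj y)) = s" using assms by (simp add: norm_mult)
  show "1 - s \<le> cmod (1 - of_real s * (x * cnj y))"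
    using norm_triangle_ineq2[of 1 "of_real s * (x * cnj y)"] n by simp
  show "cmod (1 - of_real s * (x * cnj y)) \<le> 2"
    using norm_triangle_ineq4[of 1 "of_real s * (x * cnj y)"] n assms by simp
qed

lemma log_kernel_ge:
  assumes "0 \<le> s" "s < 1" "x \<in> circle" "y \<in> circle"
  shows "- ln 2 \<le> log_kernel s x y"
proof -
  have "0 < cmod (1 - of_real s * (x * cnj y))"
    using norm_one_minus_ge(1)[OF assms] assms by linarith
  then show ?thesis
    using norm_one_minus_ge(2)[OF assms] by (simp add: log_kernel_def)
qed

text \<open>For \<open>|u| = 1\<close> one has \<open>|1 - s u|\<^sup>2 = (1 - s)\<^sup>2 + s |1 - u|\<^sup>2\<close>.\<close>

lemma log_kernel_le:
  assumes "0 < s" "s < 1" "x \<in> circle" "y \<in> circle" "x \<noteq> y"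
  shows "log_kernel s x y \<le> - ln (dist x y) - ln s / 2"
proof -
  define u where "u = x * cnj y"
  have u: "(Re u)\<^sup>2 + (Im u)\<^sup>2 = 1"
    using assms cmod_power2[of u] by (simp add: u_def norm_mult)
  have "dist x y = cmod ((1 - u) * y)"
    using assms circle_mult_cnj[of y] by (simp add: u_def dist_norm algebra_simps norm_minus_commute)
  also have "\<dots> = cmod (1 - u)" using assms by (simp add: norm_mult)
  finally have d: "dist x y = cmod (1 - u)" .
  have "(sqrt s * cmod (1 - u))\<^sup>2 = s * ((1 - Re u)\<^sup>2 + (Im u)\<^sup>2)"
    using assms by (simp add: power_mult_distrib cmod_power2)
  also have "\<dots> \<le> s * ((1 - Re u)\<^sup>2 + (Im u)\<^sup>2) + (1 - s)\<^sup>2" by simp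
  also have "\<dots> = s * (1 - 2 * Re u + ((Re u)\<^sup>2 + (Im u)\<^sup>2)) + (1 - s)\<^sup>2"
    by (simp add: power2_diff algebra_simps)
  also have "\<dots> = 1 - 2 * s * Re u + s\<^sup>2 * ((Re u)\<^sup>2 + (Im u)\<^sup>2)"
    unfolding u by (simp add: power2_diff algebra_simps)
  also have "\<dots> = (cmod (1 - of_real s * u))\<^sup>2"
    unfolding cmod_power2 by (simp add: power2_eq_square algebra_simps)
  finally have le: "sqrt s * cmod (1 - u) \<le> cmod (1 - of_real s * u)"
    by (rule power2_le_imp_le) simp
  have pos: "0 < cmod (1 - u)" using assms d by (metis zero_less_dist_iff)
  have "ln (sqrt s * cmod (1 - u)) \<le> ln (cmod (1 - of_real s * u))"
    using le pos assms by (intro ln_mono) auto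
  then show ?thesis
    using pos assms by (simp add: log_kernel_def u_def[symmetric] d ln_mult ln_sqrt)
qed

text \<open>Real part of the power series of \<open>- Ln (1 - u)\<close> at a point \<open>u\<close>
  of the open disc; on the circle \<open>cnj y\<close> is the inverse of \<open>y\<close>, whence
  the negative power.\<close>

lemma log_kernel_sums:
  assumes "0 \<le> s" "s < 1" "x \<in> circle" "y \<in> circle"
  shows "(\<lambda>n. s ^ Suc n / real (Suc n) * Re (x powi pos_freq n * y powi neg_freq n)) sums log_kernel s x y"
proof -
  define u where "u = of_real s * (x * cnj y)"
  have nu: "cmod u < 1" using assms by (simp add: u_def norm_mult)
  have "(\<lambda>n. - (u ^ n) / of_nat n) sums Ln (1 - u)"
    using Ln_series'[of "- u"] nu by simp
  then have "(\<lambda>n. - (u ^ Suc n) / of_nat (Suc n)) sums Ln (1 - u)"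
    by (subst sums_Suc_iff) simp
  then have "(\<lambda>n. - (- (u ^ Suc n) / of_nat (Suc n))) sums - Ln (1 - u)"
    by (rule sums_minus)
  then have "(\<lambda>n. Re (- (- (u ^ Suc n) / of_nat (Suc n)))) sums Re (- Ln (1 - u))"
    by (rule sums_Re)
  moreover have "Re (- Ln (1 - u)) = log_kernel s x y"
  proof -
    have "1 - u \<noteq> 0" using nu by auto
    then show ?thesis by (simp add: log_kernel_def u_def)
  qed
  moreover have "Re (- (- (u ^ Suc n) / of_nat (Suc n))) = s ^ Suc n / real (Suc n) * Re (x powi pos_freq n * y powi neg_freq n)" for n
  proof -
    have "- (- (u ^ Suc n) / of_nat (Suc n)) = of_real (s ^ Suc n / real (Suc n)) * (x ^ Suc n * cnj y ^ Suc n)"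
      unfolding u_def power_mult_distrib by (simp del: of_nat_Suc power_Suc)
    also have "cnj y ^ Suc n = y powi neg_freq n"
      using cnj_powi_circle[OF assms(4), of "pos_freq n"] by (simp only: power_int_of_nat complex_cnj_power)
    also have "x ^ Suc n = x powi pos_freq n" by (simp only: power_int_of_nat)
    finally show ?thesis by (simp only: Re_complex_of_real Im_complex_of_real times_complex.sel(1)[of "complex_of_real _"] mult_zero_left diff_zero)
  qed
  ultimately show ?thesis by simp
qed

lemma continuous_log_kernel:
  assumes "0 \<le> s" "s < 1" "x \<in> circle"
  shows "continuous_on circle (\<lambda>y. log_kernel s x y)"
  unfolding log_kernel_def
proof (intro continuous_intros ballI)
  fix y :: complex assume "y \<in> circle"
  from norm_one_minus_ge(1)[OF assms this]
  show "cmod (1 - of_real s * (x * cnj y)) \<noteq> 0" using assms by auto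
qed

section \<open>Logarithmic energy and moments\<close>

definition moment :: "complex measure \<Rightarrow> nat \<Rightarrow> complex" where
  "moment M n = (LINT z|M. z powi pos_freq n)"

lemma moment_neg:
  assumes "circle_prob M" shows "(LINT z|M. z powi neg_freq n) = cnj (moment M n)"
proof -
  have "(LINT z|M. z powi neg_freq n) = (LINT z|M. cnj (z powi pos_freq n))"
    by (rule integral_circle_cong[OF assms]) (simp only: cnj_powi_circle)
  then show ?thesis unfolding moment_def integral_cnj_circle .
qed

lemma measurable_log_kernel:
  assumes "circle_prob M"
  shows "(\<lambda>p. log_kernel s (fst p) (snd p)) \<in> borel_measurable (M \<Otimes>\<^sub>M M)"
  unfolding log_kernel_def using measurable_circle_fst_snd[OF assms] by measurable

lemma log_kernel_abs_le:
  assumes "0 \<le> s" "s < 1" "x \<in> circle" "y \<in> circle"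
  shows "\<bar>log_kernel s x y\<bar> \<le> ln 2 - ln (1 - s)"
proof -
  have "1 - s \<le> cmod (1 - of_real s * (x * cnj y))" using norm_one_minus_ge(1)[OF assms] .
  then have "ln (1 - s) \<le> ln (cmod (1 - of_real s * (x * cnj y)))"
    using assms by (intro ln_mono) auto
  moreover have "ln (1 - s) \<le> 0" using assms by simp
  moreover have "0 \<le> ln (2::real)" by simp
  ultimately show ?thesis
    using log_kernel_ge[OF assms] unfolding log_kernel_def by linarith
qed

text \<open>A geometric series dominates uniformly on the torus, so the expansion integrates term by
  term; by Fubini each term factors into a moment and its conjugate.\<close>

lemma log_kernel_double_integral:
  assumes M: "circle_prob M" and s: "0 \<le> s" "s < 1"
  shows "integrable (M \<Otimes>\<^sub>M M) (\<lambda>p. log_kernel s (fst p) (snd p))"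
    and "(\<lambda>n. s ^ Suc n * ((cmod (moment M n))\<^sup>2 / real (Suc n)))
      sums (LINT p|(M \<Otimes>\<^sub>M M). log_kernel s (fst p) (snd p))"
proof -
  interpret prob_space M using M by (rule circle_prob_prob_space)
  interpret P: pair_prob_space M M ..
  have sp: "space (M \<Otimes>\<^sub>M M) = circle \<times> circle"
    by (simp add: space_pair_measure space_circle_prob[OF M])
  show "integrable (M \<Otimes>\<^sub>M M) (\<lambda>p. log_kernel s (fst p) (snd p))"
    by (rule P.integrable_const_bound[of _ "ln 2 - ln (1 - s)"])
       (use measurable_log_kernel[OF M] log_kernel_abs_le[OF s] in \<open>auto simp: sp\<close>)
  define f where "f n p = s ^ Suc n / real (Suc n) * Re (fst p powi pos_freq n * snd p powi neg_freq n)" for n and p :: "complex \<times> complex"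
  have fm: "(\<lambda>p. fst p powi k * snd p powi l) \<in> borel_measurable (M \<Otimes>\<^sub>M M)" for k l
    using measurable_compose[OF measurable_fst measurable_powi_circle[OF M]]
      measurable_compose[OF measurable_snd measurable_powi_circle[OF M]] by measurable
  have ci: "integrable (M \<Otimes>\<^sub>M M) (\<lambda>p. fst p powi k * snd p powi l)" for k l :: int
    by (rule P.integrable_const_bound[of _ 1]) (use fm in \<open>auto simp: sp norm_mult norm_power_int\<close>)
  have fi: "integrable (M \<Otimes>\<^sub>M M) (f n)" for n
    unfolding f_def using ci by (intro integrable_mult_right integrable_Re)
  have fb: "norm (f n p) \<le> s ^ n" if "p \<in> circle \<times> circle" for n p
  proof -
    have "\<bar>Re (fst p powi pos_freq n * snd p powi neg_freq n)\<bar> \<le> 1"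
      using abs_Re_le_cmod[of "fst p powi pos_freq n * snd p powi neg_freq n"] that
      by (auto simp: norm_mult norm_power_int)
    then have "norm (f n p) \<le> s ^ Suc n / real (Suc n) * 1"
      unfolding f_def norm_mult using s by (intro mult_mono) auto
    also have "\<dots> \<le> s ^ Suc n" using s by (simp add: field_simps del: power_Suc)
    also have "\<dots> \<le> s ^ n" using s by (intro power_decreasing) auto
    finally show ?thesis .
  qed
  have sum: "summable (\<lambda>n. s ^ n)" using s by (intro summable_geometric) auto
  have "(\<lambda>n. LINT p|(M \<Otimes>\<^sub>M M). f n p) sums (LINT p|(M \<Otimes>\<^sub>M M). (\<Sum>n. f n p))"
  proof (rule sums_integral[OF fi])
    show "AE p in M \<Otimes>\<^sub>M M. summable (\<lambda>n. norm (f n p))"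
      by (rule AE_I2, rule summable_comparison_test'[OF sum]) (use fb sp in auto)
    show "summable (\<lambda>n. LINT p|(M \<Otimes>\<^sub>M M). norm (f n p))"
    proof (rule summable_comparison_test'[OF sum])
      fix n
      have "(LINT p|(M \<Otimes>\<^sub>M M). norm (f n p)) \<le> (LINT p|(M \<Otimes>\<^sub>M M). s ^ n)"
        using fb sp by (intro integral_mono integrable_norm fi) auto
      then show "norm (LINT p|(M \<Otimes>\<^sub>M M). norm (f n p)) \<le> s ^ n" by (simp add: P.prob_space)
    qed
  qed
  also have "(LINT p|(M \<Otimes>\<^sub>M M). (\<Sum>n. f n p)) = (LINT p|(M \<Otimes>\<^sub>M M). log_kernel s (fst p) (snd p))"
  proof (rule Bochner_Integration.integral_cong[OF refl])
    fix p assume "p \<in> space (M \<Otimes>\<^sub>M M)"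
    then have "fst p \<in> circle" "snd p \<in> circle" by (auto simp: sp)
    from sums_unique[OF log_kernel_sums[OF s this]]
    show "(\<Sum>n. f n p) = log_kernel s (fst p) (snd p)" by (simp only: f_def)
  qed
  also have "(\<lambda>n. LINT p|(M \<Otimes>\<^sub>M M). f n p) = (\<lambda>n. s ^ Suc n * ((cmod (moment M n))\<^sup>2 / real (Suc n)))"
  proof
    fix n
    have "(LINT p|(M \<Otimes>\<^sub>M M). fst p powi pos_freq n * snd p powi neg_freq n)
       = (LINT x|M. LINT y|M. x powi pos_freq n * y powi neg_freq n)"
      using P.integral_fst'[OF ci, of "pos_freq n" "neg_freq n"] by (simp only: fst_conv snd_conv)
    also have "\<dots> = (LINT x|M. x powi pos_freq n * cnj (moment M n))"
      by (simp only: integral_mult_right_zero moment_neg[OF M])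
    also have "\<dots> = moment M n * cnj (moment M n)"
      unfolding integral_mult_left_zero moment_def ..
    finally have "Re (LINT p|(M \<Otimes>\<^sub>M M). fst p powi pos_freq n * snd p powi neg_freq n) = (cmod (moment M n))\<^sup>2"
      by (simp only: complex_norm_square[symmetric] Re_complex_of_real)
    moreover have "(LINT p|(M \<Otimes>\<^sub>M M). f n p)
       = s ^ Suc n / real (Suc n) * Re (LINT p|(M \<Otimes>\<^sub>M M). fst p powi pos_freq n * snd p powi neg_freq n)"
      unfolding f_def integral_mult_right_zero integral_Re[OF ci] ..
    ultimately show "(LINT p|(M \<Otimes>\<^sub>M M). f n p) = s ^ Suc n * ((cmod (moment M n))\<^sup>2 / real (Suc n))"
      by simp
  qed
  finally show "(\<lambda>n. s ^ Suc n * ((cmod (moment M n))\<^sup>2 / real (Suc n)))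
      sums (LINT p|(M \<Otimes>\<^sub>M M). log_kernel s (fst p) (snd p))" .
qed

section \<open>The logarithmic energy as a limit of truncated energies\<close>

text \<open>Adding \<open>ln 2\<close> makes the logarithmic kernel nonnegative on the circle, so that its double
  integral makes sense in \<^typ>\<open>ennreal\<close>.\<close>

definition dist_defect :: "complex \<times> complex \<Rightarrow> ennreal" where
  "dist_defect p = (if fst p = snd p then \<infinity> else ennreal (ln 2 - ln (dist (fst p) (snd p))))"

lemma measurable_dist_fun:
  assumes "circle_prob M" "\<psi> \<in> borel_measurable borel"
  shows "(\<lambda>p. \<psi> (dist (fst p) (snd p))) \<in> borel_measurable (M \<Otimes>\<^sub>M M)"
  using assms(2) measurable_circle_fst_snd[OF assms(1)] by measurable

lemma measurable_dist_defect:
  assumes "circle_prob M" shows "dist_defect \<in> borel_measurable (M \<Otimes>\<^sub>M M)"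
proof -
  have "(\<lambda>r::real. if r = 0 then \<infinity> else ennreal (ln 2 - ln r)) \<in> borel_measurable borel"
    by measurable
  from measurable_dist_fun[OF assms this] show ?thesis
    by (simp add: dist_defect_def[abs_def])
qed

lemma measurable_log_dist:
  assumes "circle_prob M" shows "(\<lambda>p. log_dist (fst p) (snd p)) \<in> borel_measurable (M \<Otimes>\<^sub>M M)"
proof -
  have "(\<lambda>r::real. if r = 0 then - \<infinity> else ereal (ln r)) \<in> borel_measurable borel"
    by measurable
  from measurable_dist_fun[OF assms this] show ?thesis
    by (simp add: log_dist_def[abs_def])
qed

text \<open>Infinite values forbid subtracting under the integral, so positive and negative parts
  are balanced by the identity \<open>pw\<close> between sums in \<open>ennreal\<close>. The
  positive part is at most \<open>ln 2\<close>, hence has a finite integral that can be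
  cancelled.\<close>

lemma ereal_integral_log_dist:
  assumes M: "circle_prob M"
  shows "ereal_integral (M \<Otimes>\<^sub>M M) (\<lambda>(x, y). log_dist x y)
    = ereal (ln 2) - enn2ereal (\<integral>\<^sup>+ p. dist_defect p \<partial>(M \<Otimes>\<^sub>M M))"
proof -
  interpret prob_space M using M by (rule circle_prob_prob_space)
  interpret P: pair_prob_space M M ..
  have sp: "space (M \<Otimes>\<^sub>M M) = circle \<times> circle"
    by (simp add: space_pair_measure space_circle_prob[OF M])
  let ?L = "\<lambda>p::complex\<times>complex. log_dist (fst p) (snd p)"
  define Pp where "Pp = (\<integral>\<^sup>+ p. e2ennreal (?L p) \<partial>(M \<Otimes>\<^sub>M M))"
  define Nn where "Nn = (\<integral>\<^sup>+ p. e2ennreal (- ?L p) \<partial>(M \<Otimes>\<^sub>M M))"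
  define D where "D = (\<integral>\<^sup>+ p. dist_defect p \<partial>(M \<Otimes>\<^sub>M M))"
  note ms = measurable_log_dist[OF M] measurable_dist_defect[OF M]
  have ln: "x \<noteq> y \<Longrightarrow> ln (dist x y) \<le> ln 2" if "x \<in> circle" "y \<in> circle" for x y :: complex
    using that norm_triangle_ineq4[of x y] by (simp add: dist_norm)
  have pw: "dist_defect p + e2ennreal (?L p) = ennreal (ln 2) + e2ennreal (- ?L p)"
    if "p \<in> circle \<times> circle" for p
  proof (cases "fst p = snd p")
    case True
    then show ?thesis by (simp add: dist_defect_def log_dist_def)
  next
    case False
    define d where "d = ln (dist (fst p) (snd p))"
    have "d \<le> ln 2" unfolding d_def using ln that False by auto
    then have "ennreal (ln 2 - d) + ennreal d = ennreal (ln 2) + ennreal (- d)"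
      by (cases "d \<ge> 0") (auto simp: ennreal_plus[symmetric] ennreal_neg simp del: ennreal_plus)
    then show ?thesis using False
      by (simp add: dist_defect_def log_dist_def d_def e2ennreal_ereal)
  qed
  have "D + Pp = (\<integral>\<^sup>+ p. dist_defect p + e2ennreal (?L p) \<partial>(M \<Otimes>\<^sub>M M))"
    unfolding D_def Pp_def using ms by (subst nn_integral_add) auto
  also have "\<dots> = (\<integral>\<^sup>+ p. ennreal (ln 2) + e2ennreal (- ?L p) \<partial>(M \<Otimes>\<^sub>M M))"
    by (rule nn_integral_cong) (simp only: sp pw)
  also have "\<dots> = ennreal (ln 2) + Nn"
    unfolding Nn_def using ms by (subst nn_integral_add) (auto simp: P.emeasure_space_1)
  finally have eq: "D + Pp = ennreal (ln 2) + Nn" .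
  have "Pp \<le> (\<integral>\<^sup>+ p. ennreal (ln 2) \<partial>(M \<Otimes>\<^sub>M M))"
    unfolding Pp_def
  proof (rule nn_integral_mono)
    fix p assume "p \<in> space (M \<Otimes>\<^sub>M M)"
    then show "e2ennreal (?L p) \<le> ennreal (ln 2)"
      using ln by (auto simp: sp log_dist_def e2ennreal_neg intro!: ennreal_leI)
  qed
  also have "\<dots> = ennreal (ln 2)" by (simp add: P.emeasure_space_1)
  finally have Pp: "Pp \<le> ennreal (ln 2)" .
  then obtain a where a: "Pp = ennreal a" "a \<ge> 0"
    by (cases Pp) (auto simp: top_unique)
  have "enn2ereal Pp - enn2ereal Nn = ereal (ln 2) - enn2ereal D"
  proof (cases Nn)
    case (real n)
    with eq a have "D + ennreal a = ennreal (ln 2 + n)" by (simp add: ennreal_plus)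
    then obtain d where d: "D = ennreal d" "d \<ge> 0" by (cases D) auto
    have "ennreal (d + a) = ennreal (ln 2 + n)"
      using d a \<open>D + ennreal a = ennreal (ln 2 + n)\<close> by (simp add: ennreal_plus)
    then have "d + a = ln 2 + n" using d a real by (subst (asm) ennreal_inj) auto
    then show ?thesis using a real d by (simp add: enn2ereal_ennreal)
  next
    case top
    with eq a have "D = \<infinity>" by (cases D) (auto simp: ennreal_plus[symmetric] simp del: ennreal_plus)
    then show ?thesis using top a by (simp add: enn2ereal_ennreal)
  qed
  then show ?thesis
    by (simp add: ereal_integral_def case_prod_beta Pp_def Nn_def D_def)
qed

lemma log_energy_eq:
  assumes "circle_prob M"
  shows "log_energy Q M = ereal ((LINT x|M. Q x) - ln 2) + enn2ereal (\<integral>\<^sup>+ p. dist_defect p \<partial>(M \<Otimes>\<^sub>M M))"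
  unfolding log_energy_def ereal_integral_log_dist[OF assms]
  by (cases "\<integral>\<^sup>+ p. dist_defect p \<partial>(M \<Otimes>\<^sub>M M)") (auto simp: enn2ereal_ennreal)

text \<open>Truncation raises the kernel by at most \<open>- ln s / 2\<close>, which vanishes as s
  tends to 1. With finite sums the limit is taken term by term, and summability of the weighted
  moments becomes a consequence of finite energy.\<close>

lemma log_energy_ge:
  assumes M: "circle_prob M" and E: "log_energy Q M \<le> ereal E"
  shows "(LINT x|M. Q x) + (\<Sum>n<N. (cmod (moment M n))\<^sup>2 / real (Suc n)) \<le> E"
proof -
  interpret prob_space M using M by (rule circle_prob_prob_space)
  interpret P: pair_prob_space M M ..
  have sp: "space (M \<Otimes>\<^sub>M M) = circle \<times> circle"
    by (simp add: space_pair_measure space_circle_prob[OF M])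
  obtain d where d: "(\<integral>\<^sup>+ p. dist_defect p \<partial>(M \<Otimes>\<^sub>M M)) = ennreal d" "d \<ge> 0"
    using E unfolding log_energy_eq[OF M] by (cases "\<integral>\<^sup>+ p. dist_defect p \<partial>(M \<Otimes>\<^sub>M M)") auto
  have dE: "(LINT x|M. Q x) - ln 2 + d \<le> E"
    using E d unfolding log_energy_eq[OF M] by (simp add: enn2ereal_ennreal)
  have le: "(\<Sum>n<N. s ^ Suc n * ((cmod (moment M n))\<^sup>2 / real (Suc n))) \<le> d - ln 2 - ln s / 2"
    if s: "0 < s" "s < 1" for s
  proof -
    have s': "0 \<le> s" using s by simp
    let ?K = "\<lambda>p. log_kernel s (fst p) (snd p)"
    note K = log_kernel_double_integral[OF M s' s(2)]
    have nn: "0 \<le> ln 2 + ?K p" if "p \<in> circle \<times> circle" for p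
      using log_kernel_ge[OF s' s(2), of "fst p" "snd p"] that by auto
    have "ennreal (LINT p|(M \<Otimes>\<^sub>M M). ln 2 + ?K p) = (\<integral>\<^sup>+ p. ennreal (ln 2 + ?K p) \<partial>(M \<Otimes>\<^sub>M M))"
      by (rule nn_integral_eq_integral[symmetric]) (use K(1) nn sp in \<open>auto intro!: AE_I2\<close>)
    also have "\<dots> \<le> (\<integral>\<^sup>+ p. dist_defect p + ennreal (- ln s / 2) \<partial>(M \<Otimes>\<^sub>M M))"
    proof (rule nn_integral_mono)
      fix p assume "p \<in> space (M \<Otimes>\<^sub>M M)"
      then have p: "fst p \<in> circle" "snd p \<in> circle" by (auto simp: sp)
      show "ennreal (ln 2 + ?K p) \<le> dist_defect p + ennreal (- ln s / 2)"
      proof (cases "fst p = snd p")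
        case False
        have "ln (dist (fst p) (snd p)) \<le> ln 2"
          using p norm_triangle_ineq4[of "fst p" "snd p"] False by (simp add: dist_norm)
        moreover have "ln s \<le> 0" using s by simp
        ultimately show ?thesis
          using log_kernel_le[OF s p False] False
          by (simp add: dist_defect_def ennreal_plus[symmetric] del: ennreal_plus) (rule ennreal_leI, simp)
      qed (simp add: dist_defect_def)
    qed
    also have "\<dots> = ennreal d + ennreal (- ln s / 2)"
      using measurable_dist_defect[OF M] d by (subst nn_integral_add) (auto simp: P.emeasure_space_1)
    also have "\<dots> = ennreal (d - ln s / 2)"
      using s d by (simp add: ennreal_plus[symmetric] del: ennreal_plus)
    finally have "(LINT p|(M \<Otimes>\<^sub>M M). ln 2 + ?K p) \<le> d - ln s / 2"
      using s d by (subst (asm) ennreal_le_iff) (auto simp: field_simps intro: order_trans[of "ln s" 0])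
    then have "(LINT p|(M \<Otimes>\<^sub>M M). ?K p) \<le> d - ln 2 - ln s / 2"
      using K(1) by (simp add: P.prob_space)
    moreover have "(\<Sum>n<N. s ^ Suc n * ((cmod (moment M n))\<^sup>2 / real (Suc n))) \<le> (LINT p|(M \<Otimes>\<^sub>M M). ?K p)"
      unfolding sums_unique[OF K(2)]
      by (rule sum_le_suminf[OF sums_summable[OF K(2)]]) (use s in auto)
    ultimately show ?thesis by simp
  qed
  \<comment> \<open>The powers of 1 and \<open>ln 1\<close> are left unsimplified so that both sides
    are literally the limits at s = 1.\<close>
  have "(\<Sum>n<N. 1 ^ Suc n * ((cmod (moment M n))\<^sup>2 / real (Suc n))) \<le> d - ln 2 - ln 1 / 2"
  proof (rule tendsto_le[of "at_left (1::real)"])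
    show "((\<lambda>s. d - ln 2 - ln s / 2) \<longlongrightarrow> d - ln 2 - ln 1 / 2) (at_left 1)"
      by (intro tendsto_intros) auto
    show "((\<lambda>s. \<Sum>n<N. s ^ Suc n * ((cmod (moment M n))\<^sup>2 / real (Suc n)))
      \<longlongrightarrow> (\<Sum>n<N. 1 ^ Suc n * ((cmod (moment M n))\<^sup>2 / real (Suc n)))) (at_left 1)"
      by (intro tendsto_intros)
    show "\<forall>\<^sub>F s in at_left 1. (\<Sum>n<N. s ^ Suc n * ((cmod (moment M n))\<^sup>2 / real (Suc n))) \<le> d - ln 2 - ln s / 2"
      by (rule eventually_mono[OF eventually_at_left_real[of 0 1]]) (use le in auto)
  qed simp
  then show ?thesis using dE by simp
qed

text \<open>Fatou's lemma gives the direction opposite to \<open>log_energy_ge\<close>: the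
  truncated double integrals stay below \<open>C\<close>, since powers of \<open>s n\<close> are at
  most 1, and the kernels converge pointwise, on the diagonal too.\<close>

lemma log_energy_le:
  assumes M: "circle_prob M" and C: "(\<lambda>n. (cmod (moment M n))\<^sup>2 / real (Suc n)) sums C"
  shows "log_energy Q M \<le> ereal ((LINT x|M. Q x) + C)"
proof -
  interpret prob_space M using M by (rule circle_prob_prob_space)
  interpret P: pair_prob_space M M ..
  have sp: "space (M \<Otimes>\<^sub>M M) = circle \<times> circle"
    by (simp add: space_pair_measure space_circle_prob[OF M])
  have C0: "0 \<le> C" by (rule sums_le[OF _ sums_zero C]) simp
  \<comment> \<open>With this choice the truncated kernel on the diagonal is
    \<open>ln (real (n + 2))\<close>, which tends to infinity, the value of
    \<open>dist_defect\<close> there.\<close>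
  define s where "s n = 1 - 1 / real (n + 2)" for n
  have s: "0 \<le> s n" "s n < 1" for n by (auto simp: s_def)
  let ?K = "\<lambda>n p. log_kernel (s n) (fst p) (snd p)"
  have sl: "s \<longlonglongrightarrow> 1"
  proof -
    have "(\<lambda>n. 1 / real (n + 2)) \<longlonglongrightarrow> 0"
      using LIMSEQ_ignore_initial_segment[OF lim_const_over_n[of "1::real"], of 2] by simp
    from tendsto_diff[OF tendsto_const this] show ?thesis unfolding s_def by simp
  qed
  have bound: "(\<integral>\<^sup>+ p. ennreal (ln 2 + ?K n p) \<partial>(M \<Otimes>\<^sub>M M)) \<le> ennreal (ln 2 + C)" for n
  proof -
    note K = log_kernel_double_integral[OF M s[of n]]
    have nn: "0 \<le> ln 2 + ?K n p" if "p \<in> circle \<times> circle" for p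
      using log_kernel_ge[OF s, of "fst p" "snd p" n] that by auto
    have "(LINT p|(M \<Otimes>\<^sub>M M). ?K n p) \<le> C"
    proof (rule sums_le[OF _ K(2) C])
      fix k
      have "s n ^ Suc k \<le> 1" using s[of n] by (intro power_le_one) auto
      then show "s n ^ Suc k * ((cmod (moment M k))\<^sup>2 / real (Suc k)) \<le> (cmod (moment M k))\<^sup>2 / real (Suc k)"
        by (intro mult_left_le_one_le) (use s[of n] in auto)
    qed
    moreover have "(\<integral>\<^sup>+ p. ennreal (ln 2 + ?K n p) \<partial>(M \<Otimes>\<^sub>M M)) = ennreal (LINT p|(M \<Otimes>\<^sub>M M). ln 2 + ?K n p)"
      by (rule nn_integral_eq_integral) (use K(1) nn sp in \<open>auto intro!: AE_I2\<close>)
    ultimately show ?thesis using K(1) by (auto simp: P.prob_space intro!: ennreal_leI)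
  qed
  have pw: "dist_defect p = liminf (\<lambda>n. ennreal (ln 2 + ?K n p))" if "p \<in> circle \<times> circle" for p
  proof -
    have p: "fst p \<in> circle" "snd p \<in> circle" using that by auto
    have "(\<lambda>n. ennreal (ln 2 + ?K n p)) \<longlonglongrightarrow> dist_defect p"
    proof (cases "fst p = snd p")
      case True
      have "?K n p = ln (real (n + 2))" for n
      proof -
        have "1 - of_real (s n) * (fst p * cnj (snd p)) = complex_of_real (1 / real (n + 2))"
          using True circle_mult_cnj[OF p(2)] by (simp add: s_def)
        then show ?thesis unfolding log_kernel_def by (simp only: norm_of_real) (simp add: ln_div)
      qed
      moreover have "filterlim (\<lambda>n. ln 2 + ln (real (n + 2))) at_top sequentially"
        by (intro filterlim_tendsto_add_at_top[OF tendsto_const] filterlim_compose[OF ln_at_top]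
            filterlim_compose[OF filterlim_real_sequentially]) (rule filterlim_add_const_nat_at_top)
      ultimately show ?thesis using True
        by (simp add: dist_defect_def ennreal_tendsto_top_eq_at_top del: ennreal_plus)
    next
      case False
      have "1 - 1 * (fst p * cnj (snd p)) = (snd p - fst p) * cnj (snd p)"
        using circle_mult_cnj[OF p(2)] by (simp add: algebra_simps)
      then have d: "cmod (1 - 1 * (fst p * cnj (snd p))) = dist (fst p) (snd p)"
        using p by (simp add: norm_mult dist_norm norm_minus_commute)
      have "(\<lambda>n. ln 2 + - ln (cmod (1 - of_real (s n) * (fst p * cnj (snd p)))))
        \<longlonglongrightarrow> ln 2 + - ln (cmod (1 - of_real 1 * (fst p * cnj (snd p))))"
        by (intro tendsto_intros sl) (use d False in auto)
      then have "(\<lambda>n. ln 2 + ?K n p) \<longlonglongrightarrow> ln 2 - ln (dist (fst p) (snd p))"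
        using d by (simp add: log_kernel_def)
      then show ?thesis using False by (simp add: dist_defect_def tendsto_ennrealI)
    qed
    then show ?thesis by (simp add: lim_imp_Liminf)
  qed
  have "(\<integral>\<^sup>+ p. dist_defect p \<partial>(M \<Otimes>\<^sub>M M)) = (\<integral>\<^sup>+ p. liminf (\<lambda>n. ennreal (ln 2 + ?K n p)) \<partial>(M \<Otimes>\<^sub>M M))"
    by (rule nn_integral_cong) (simp only: sp pw)
  also have "\<dots> \<le> liminf (\<lambda>n. \<integral>\<^sup>+ p. ennreal (ln 2 + ?K n p) \<partial>(M \<Otimes>\<^sub>M M))"
    by (rule nn_integral_liminf) (use measurable_log_kernel[OF M] in measurable)
  also have "\<dots> \<le> ennreal (ln 2 + C)"
    by (rule order_trans[OF Liminf_le_Limsup Limsup_bounded]) (use bound in auto)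
  finally have "enn2ereal (\<integral>\<^sup>+ p. dist_defect p \<partial>(M \<Otimes>\<^sub>M M)) \<le> ereal (ln 2 + C)"
    using C0 by (simp add: less_eq_ennreal.rep_eq enn2ereal_ennreal del: ennreal_plus)
  from add_left_mono[OF this, of "ereal ((LINT x|M. Q x) - ln 2)"]
  show ?thesis unfolding log_energy_eq[OF M] by simp
qed

section \<open>The equilibrium measure\<close>

text \<open>\<open>circle_deriv\<close> differentiates at angle 0 from a moving base point; shifting
  the angle makes it the derivative of one periodic function at every \<open>t\<close>.\<close>

lemma has_vector_derivative_circle_deriv:
  fixes f :: "complex \<Rightarrow> 'a::real_normed_vector"
  assumes "\<forall>z\<in>circle. (\<lambda>t. f (z * cis t)) differentiable (at 0)"
  shows "((\<lambda>t. f (cis t)) has_vector_derivative circle_deriv f (cis t)) (at t)"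
proof -
  have "((\<lambda>s. f (cis t * cis s)) has_vector_derivative circle_deriv f (cis t)) (at (t - t))"
    using assms vector_derivative_works[of "\<lambda>s. f (cis t * cis s)" "at 0"] by (simp add: circle_deriv_def)
  moreover have "((\<lambda>s. s - t) has_vector_derivative 1) (at t)"
    by (auto intro!: derivative_eq_intros)
  ultimately show ?thesis
    using vector_diff_chain_at[of "\<lambda>s. s - t" 1 t "\<lambda>s. f (cis t * cis s)"] by (simp add: o_def cis_mult)
qed

lemma circle_C1_complex:
  assumes "C_k_on_circle (Suc 0) f" shows "circle_C1 f (circle_deriv f)"
  using assms has_vector_derivative_circle_deriv[of f] by (auto simp: circle_C1_def)

lemma circle_C1_real:
  fixes f :: "complex \<Rightarrow> real"
  assumes "C_k_on_circle (Suc 0) f"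
  shows "circle_C1 (\<lambda>z. of_real (f z)) (\<lambda>z. of_real (circle_deriv f z))"
  using assms bounded_linear.has_vector_derivative[OF bounded_linear_of_real has_vector_derivative_circle_deriv[of f]]
  by (auto simp: circle_C1_def intro!: continuous_intros)

text \<open>\<open>C_k_on_circle\<close> states continuity for the last derivative only. Continuity
  of the function itself is recovered by induction, each step using that C^1 functions are
  Lipschitz.\<close>

lemma C_k_on_circle_continuous_complex:
  fixes f :: "complex \<Rightarrow> complex"
  shows "C_k_on_circle k f \<Longrightarrow> continuous_on circle f"
proof (induction k arbitrary: f)
  case (Suc k)
  then have "C_k_on_circle (Suc 0) f" by simp
  then show ?case using circle_C1_complex circle_C1_continuous by blast
qed simp

lemma C_k_on_circle_continuous_real:
  fixes f :: "complex \<Rightarrow> real"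
  shows "C_k_on_circle k f \<Longrightarrow> continuous_on circle f"
proof (induction k arbitrary: f)
  case (Suc k)
  then have "C_k_on_circle (Suc 0) f" by simp
  from continuous_on_Re[OF circle_C1_continuous[OF circle_C1_real[OF this]]]
  show ?case by simp
qed simp

lemma fourier_of_real_neg: "fourier (\<lambda>z. of_real (r z)) (- k) = cnj (fourier (\<lambda>z. of_real (r z)) k)"
  using fourier_cnj[of "\<lambda>z. of_real (r z)" k] by (simp add: fourier_def)

text \<open>This is the integrand on the right of the final inequality. The minimizer is compared
  with the candidate on C^1 test functions, so the integrand has to be recognized as one.\<close>

lemma circle_C1_norm_square:
  assumes "circle_C1 p p'"
  shows "circle_C1 (\<lambda>z. of_real ((cmod (p z - c))\<^sup>2)) (\<lambda>z. (p z - c) * cnj (p' z) + p' z * cnj (p z - c))"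
  unfolding complex_norm_square circle_C1_def
proof (intro conjI allI)
  have c: "continuous_on circle p" "continuous_on circle p'"
    and d: "((\<lambda>t. p (cis t)) has_vector_derivative p' (cis t)) (at t)" for t
    using assms circle_C1_continuous by (auto simp: circle_C1_def)
  show "continuous_on circle (\<lambda>z. (p z - c) * cnj (p' z) + p' z * cnj (p z - c))"
    using c by (intro continuous_intros)
  fix t
  have d': "((\<lambda>t. p (cis t) - c) has_vector_derivative p' (cis t)) (at t)"
    using has_vector_derivative_diff[OF d has_vector_derivative_const] by simp
  show "((\<lambda>t. (p (cis t) - c) * cnj (p (cis t) - c)) has_vector_derivative
      (p (cis t) - c) * cnj (p' (cis t)) + p' (cis t) * cnj (p (cis t) - c)) (at t)"
    by (rule has_vector_derivative_mult[OF d' bounded_linear.has_vector_derivative[OF bounded_linear_cnj d']])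
qed

text \<open>Integration against the truncated kernel produces, up to the factor 2, the Abel means of
  the series in \<open>eq_density\<close>; a bound for the kernel thereby becomes a bound for the
  density.\<close>

lemma integral_log_kernel:
  fixes R :: "complex \<Rightarrow> real"
  assumes R: "continuous_on circle R" and s: "0 \<le> s" "s < 1" and z: "z \<in> circle"
  shows "(\<lambda>n. s ^ Suc n / real (Suc n) * Re (fourier (\<lambda>w. of_real (R w)) (pos_freq n) * z powi pos_freq n))
    sums (LINT w|circle_haar. R w * log_kernel s z w)"
proof -
  note cp = circle_prob_circle_haar
  interpret prob_space circle_haar using cp by (rule circle_prob_prob_space)
  define f where "f n w = s ^ Suc n / real (Suc n) * Re (z powi pos_freq n * (of_real (R w) * w powi neg_freq n))" for n w
  have ci: "integrable circle_haar (\<lambda>w. of_real (R w) * w powi k)" for k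
    using R by (auto intro!: haar_integrable continuous_intros)
  have fi: "integrable circle_haar (f n)" for n
    unfolding f_def by (intro integrable_mult_right integrable_Re ci)
  obtain B where B: "B \<ge> 0" "\<And>w. w \<in> circle \<Longrightarrow> norm (R w) \<le> B"
    using continuous_circle_bounded[OF R] by metis
  have fb: "norm (f n w) \<le> s ^ n * B" if w: "w \<in> circle" for n w
  proof -
    have "\<bar>Re (z powi pos_freq n * (of_real (R w) * w powi neg_freq n))\<bar> \<le> B"
      using abs_Re_le_cmod[of "z powi pos_freq n * (of_real (R w) * w powi neg_freq n)"] w z B(2)[OF w]
      by (auto simp: norm_mult norm_power_int)
    then have "norm (f n w) \<le> s ^ Suc n / real (Suc n) * B"
      unfolding f_def norm_mult using s by (intro mult_mono) auto
    also have "s ^ Suc n / real (Suc n) \<le> s ^ Suc n" using s by (simp add: field_simps del: power_Suc)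
    also have "s ^ Suc n \<le> s ^ n" using s by (intro power_decreasing) auto
    finally show ?thesis using B(1) by (simp add: mult_right_mono)
  qed
  have sum: "summable (\<lambda>n. s ^ n * B)" using s by (intro summable_mult2 summable_geometric) auto
  have "(\<lambda>n. LINT w|circle_haar. f n w) sums (LINT w|circle_haar. (\<Sum>n. f n w))"
  proof (rule sums_integral[OF fi])
    show "AE w in circle_haar. summable (\<lambda>n. norm (f n w))"
      by (rule AE_I2, rule summable_comparison_test'[OF sum]) (use fb space_circle_prob[OF cp] in auto)
    show "summable (\<lambda>n. LINT w|circle_haar. norm (f n w))"
    proof (rule summable_comparison_test'[OF sum])
      fix n
      have "(LINT w|circle_haar. norm (f n w)) \<le> (LINT w|circle_haar. s ^ n * B)"
        using fb space_circle_prob[OF cp] by (intro integral_mono integrable_norm fi) auto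
      then show "norm (LINT w|circle_haar. norm (f n w)) \<le> s ^ n * B" by (simp add: prob_space)
    qed
  qed
  also have "(LINT w|circle_haar. (\<Sum>n. f n w)) = (LINT w|circle_haar. R w * log_kernel s z w)"
  proof (rule integral_circle_cong[OF cp])
    fix w :: complex assume w: "w \<in> circle"
    have "f n w = R w * (s ^ Suc n / real (Suc n) * Re (z powi pos_freq n * w powi neg_freq n))" for n
    proof -
      have "z powi pos_freq n * (of_real (R w) * w powi neg_freq n) = of_real (R w) * (z powi pos_freq n * w powi neg_freq n)"
        by (simp only: mult_ac)
      then show ?thesis unfolding f_def by (simp only: Re_complex_of_real Im_complex_of_real times_complex.sel(1)[of "complex_of_real _"] mult_zero_left diff_zero mult_ac)
    qed
    then show "(\<Sum>n. f n w) = R w * log_kernel s z w"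
      using sums_unique[OF sums_mult[OF log_kernel_sums[OF s z w], of "R w"]] by simp
  qed
  also have "(\<lambda>n. LINT w|circle_haar. f n w)
    = (\<lambda>n. s ^ Suc n / real (Suc n) * Re (fourier (\<lambda>w. of_real (R w)) (pos_freq n) * z powi pos_freq n))"
    unfolding f_def integral_mult_right_zero integral_Re[OF integrable_mult_right[OF ci]] fourier_def
    by (simp only: mult.commute)
  finally show ?thesis .
qed

text \<open>Dominated convergence for series: for s in (0, 1) the terms are dominated by
  \<open>|a n|\<close>.\<close>

lemma abel_tendsto:
  fixes a :: "nat \<Rightarrow> real"
  assumes "summable (\<lambda>n. \<bar>a n\<bar>)"
  shows "((\<lambda>s. \<Sum>n. s ^ Suc n * a n) \<longlongrightarrow> (\<Sum>n. a n)) (at_left 1)"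
proof -
  have "((\<lambda>s. s ^ Suc n * a n) \<longlongrightarrow> 1 ^ Suc n * a n) (at_left 1)" for n
    by (intro tendsto_intros)
  then have 1: "((\<lambda>s. s ^ Suc n * a n) \<longlongrightarrow> a n) (at_left 1)" for n by simp
  have "\<forall>\<^sub>F p in (at_top :: nat filter) \<times>\<^sub>F at_left (1::real). True \<and> snd p \<in> {0<..<1}"
    by (rule eventually_prodI[OF always_eventually eventually_at_left_real]) auto
  then have 2: "\<forall>\<^sub>F (n, s) in at_top \<times>\<^sub>F at_left 1. norm (s ^ Suc n * a n) \<le> \<bar>a n\<bar>"
  proof (rule eventually_mono, clarify)
    fix n :: nat and s :: real assume "snd (n, s) \<in> {0<..<1}"
    then have "\<bar>s ^ Suc n\<bar> \<le> 1" by (auto intro!: power_le_one simp del: power_Suc)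
    then show "norm (s ^ Suc n * a n) \<le> \<bar>a n\<bar>"
      unfolding real_norm_def abs_mult by (intro mult_left_le_one_le) auto
  qed
  show ?thesis using tannerys_theorem[OF 1 2 assms] by simp
qed

section \<open>The candidate measure, its density and its moments\<close>

text \<open>The density of the equilibrium measure with respect to the Haar measure, written in terms
  of the Fourier coefficients of \<open>r = Q''\<close>.\<close>

definition eq_density :: "(complex \<Rightarrow> real) \<Rightarrow> complex \<Rightarrow> real" where
  "eq_density r z = 1 + (\<Sum>n. 2 / real (Suc n) * Re (fourier (\<lambda>w. of_real (r w)) (pos_freq n) * z powi pos_freq n))"

definition eq_measure :: "(complex \<Rightarrow> real) \<Rightarrow> complex measure" where
  "eq_measure r = density circle_haar (\<lambda>z. ennreal (eq_density r z))"

text \<open>\<open>q1\<close>, \<open>q2\<close>, \<open>q3\<close> stand for the successive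
  derivatives of \<open>Q\<close>; \<open>q2\<close> is kept real because it determines the density.
  Through \<open>q3\<close> its Fourier coefficients are absolutely summable, and the density is
  bounded.\<close>

context
  fixes Q :: "complex \<Rightarrow> real" and q2 :: "complex \<Rightarrow> real" and q1 q3 :: "complex \<Rightarrow> complex"
  assumes Q: "circle_C1 (\<lambda>z. of_real (Q z)) q1" "circle_C1 q1 (\<lambda>z. of_real (q2 z))"
    "circle_C1 (\<lambda>z. of_real (q2 z)) q3"
begin

abbreviation "c2 \<equiv> \<lambda>n. fourier (\<lambda>w. of_real (q2 w)) (pos_freq n)"

lemma summable_c2: "summable (\<lambda>n. 2 * cmod (c2 n))"
  by (intro summable_mult summable_comparison_test'[OF summable_fourier[OF Q(3)]]) simp

lemma c2_term_le: "z \<in> circle \<Longrightarrow> \<bar>2 / real (Suc n) * Re (c2 n * z powi pos_freq n)\<bar> \<le> 2 * cmod (c2 n)"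
proof -
  assume z: "z \<in> circle"
  have "\<bar>Re (c2 n * z powi pos_freq n)\<bar> \<le> cmod (c2 n)"
    using abs_Re_le_cmod[of "c2 n * z powi pos_freq n"] z by (simp add: norm_mult norm_power_int)
  then have "\<bar>2 / real (Suc n)\<bar> * \<bar>Re (c2 n * z powi pos_freq n)\<bar> \<le> 2 * cmod (c2 n)"
    by (intro mult_mono) (auto simp: field_simps)
  then show ?thesis by (simp only: abs_mult)
qed

lemma eq_density_abs_le: "z \<in> circle \<Longrightarrow> \<bar>eq_density q2 z\<bar> \<le> 1 + (\<Sum>n. 2 * cmod (c2 n))"
proof -
  assume z: "z \<in> circle"
  have s: "summable (\<lambda>n. \<bar>2 / real (Suc n) * Re (c2 n * z powi pos_freq n)\<bar>)"
    by (rule summable_comparison_test'[OF summable_c2]) (use c2_term_le[OF z] in auto)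
  have "\<bar>\<Sum>n. 2 / real (Suc n) * Re (c2 n * z powi pos_freq n)\<bar> \<le> (\<Sum>n. \<bar>2 / real (Suc n) * Re (c2 n * z powi pos_freq n)\<bar>)"
    by (rule summable_rabs[OF s])
  also have "\<dots> \<le> (\<Sum>n. 2 * cmod (c2 n))"
    by (rule suminf_le[OF c2_term_le[OF z] s summable_c2])
  finally show ?thesis unfolding eq_density_def by linarith
qed

lemma measurable_eq_density: "eq_density q2 \<in> borel_measurable circle_haar"
proof -
  have [measurable]: "(\<lambda>z. Re (c2 n * z powi pos_freq n)) \<in> borel_measurable circle_haar" for n
    by (rule haar_measurable) (auto intro!: continuous_intros)
  show ?thesis unfolding eq_density_def[abs_def] by measurable
qed

lemma integral_q2: "(LINT z|circle_haar. q2 z) = 0"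
proof -
  have "complex_of_real (LINT z|circle_haar. q2 z) = 0"
    using integral_circle_haar_deriv[OF Q(2)] by simp
  then show ?thesis by (simp only: of_real_eq_0_iff)
qed

lemma continuous_q2: "continuous_on circle q2"
  using continuous_on_Re[OF circle_C1_continuous[OF Q(3)]] by simp

text \<open>The bound is proved for Abel means with s < 1, where the kernel is continuous and at
  least \<open>- ln 2\<close>; absolute summability carries it to s = 1. Passing from
  \<open>q2\<close> to \<open>R\<close> makes the weight nonnegative and leaves the coefficients at
  nonzero frequencies as they are.\<close>

lemma eq_density_ge:
  assumes l: "\<And>z. z \<in> circle \<Longrightarrow> q2 z \<ge> - l" and z: "z \<in> circle"
  shows "1 - 2 * l \<le> eq_density q2 z"
proof -
  note cp = circle_prob_circle_haar
  note sp = space_circle_prob[OF cp]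
  interpret prob_space circle_haar using cp by (rule circle_prob_prob_space)
  define R where "R w = q2 w + l" for w
  have Rc: "continuous_on circle R" unfolding R_def using continuous_q2 by (intro continuous_intros)
  have Ri: "(LINT w|circle_haar. R w) = l"
    unfolding R_def using integral_q2 haar_integrable[OF continuous_q2] by (simp add: prob_space)
  have R0: "w \<in> circle \<Longrightarrow> 0 \<le> R w" for w using l[of w] by (simp add: R_def)
  have l0: "0 \<le> l"
    unfolding Ri[symmetric] by (rule integral_nonneg_AE) (use R0 sp in \<open>auto intro!: AE_I2\<close>)
  have fR: "fourier (\<lambda>w. of_real (R w)) (pos_freq n) = c2 n" for n
  proof -
    have "integrable circle_haar (\<lambda>w. of_real (q2 w) * w powi neg_freq n)"
      "integrable circle_haar (\<lambda>w. complex_of_real l * w powi neg_freq n)"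
      using continuous_q2 by (auto intro!: haar_integrable continuous_intros)
    then have "fourier (\<lambda>w. of_real (R w)) (pos_freq n) = c2 n + of_real l * (LINT w|circle_haar. w powi neg_freq n)"
      unfolding R_def fourier_def of_real_add distrib_right
      by (subst Bochner_Integration.integral_add) auto
    then show ?thesis by (simp add: integral_circle_haar_powi)
  qed
  let ?a = "\<lambda>n. 2 / real (Suc n) * Re (c2 n * z powi pos_freq n)"
  have sa: "summable (\<lambda>n. \<bar>?a n\<bar>)"
    by (rule summable_comparison_test'[OF summable_c2]) (use c2_term_le[OF z] in auto)
  have "- 2 * l \<le> (\<Sum>n. s ^ Suc n * ?a n)" if s: "0 < s" "s < 1" for s
  proof -
    have s': "0 \<le> s" using s by simp
    have move: "2 * (a / b * x) = a * (2 / b * x)" for a b x :: real by simp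
    have "(\<lambda>n. 2 * (s ^ Suc n / real (Suc n) * Re (c2 n * z powi pos_freq n)))
      sums (2 * (LINT w|circle_haar. R w * log_kernel s z w))"
      using sums_mult[OF integral_log_kernel[OF Rc s' s(2) z]] unfolding fR .
    then have "(\<Sum>n. s ^ Suc n * ?a n) = 2 * (LINT w|circle_haar. R w * log_kernel s z w)"
      unfolding move by (rule sums_unique[symmetric])
    moreover have "(LINT w|circle_haar. R w * (- ln 2)) \<le> (LINT w|circle_haar. R w * log_kernel s z w)"
    proof (rule integral_mono)
      show "integrable circle_haar (\<lambda>w. R w * log_kernel s z w)"
        using Rc continuous_log_kernel[OF s' s(2) z] by (auto intro!: haar_integrable continuous_intros)
      show "integrable circle_haar (\<lambda>w. R w * - ln 2)"
        using Rc by (auto intro!: haar_integrable continuous_intros)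
      fix w assume "w \<in> space circle_haar"
      then have w: "w \<in> circle" by (simp add: sp)
      show "R w * - ln 2 \<le> R w * log_kernel s z w"
        by (intro mult_left_mono log_kernel_ge[OF s' s(2) z w] R0[OF w])
    qed
    moreover have "(LINT w|circle_haar. R w * (- ln 2)) = - (l * ln 2)" by (simp add: Ri)
    moreover have "l * ln 2 \<le> l"
      using ln_le_minus_one[of "2::real"] l0 by (simp add: mult_left_le)
    ultimately show ?thesis by linarith
  qed
  then have "- 2 * l \<le> (\<Sum>n. ?a n)"
    by (intro tendsto_lowerbound[OF abel_tendsto[OF sa]] eventually_mono[OF eventually_at_left_real[of 0 1]]) auto
  then show ?thesis by (simp add: eq_density_def)
qed

text \<open>Orthogonality after integration term by term: for \<open>k = 0\<close> no term of the
  density series contributes, and for \<open>k = pos_freq m\<close> only the conjugate half of the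
  term with index \<open>m\<close> does.\<close>

lemma integral_eq_density_powi:
  shows "(LINT z|circle_haar. of_real (eq_density q2 z)) = (1::complex)"
    and "(LINT z|circle_haar. of_real (eq_density q2 z) * z powi pos_freq m) = cnj (c2 m) / of_nat (Suc m)"
proof -
  note cp = circle_prob_circle_haar
  note sp = space_circle_prob[OF cp]
  interpret prob_space circle_haar using cp by (rule circle_prob_prob_space)
  let ?a = "\<lambda>n z. 2 / real (Suc n) * Re (c2 n * z powi pos_freq n)"
  have main: "(\<lambda>n. (c2 n * (LINT z|circle_haar. z powi (k + pos_freq n)) + cnj (c2 n) * (LINT z|circle_haar. z powi (k - pos_freq n))) / of_nat (Suc n))
      sums ((LINT z|circle_haar. of_real (eq_density q2 z) * z powi k) - (LINT z|circle_haar. z powi k))" for k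
  proof -
    define f where "f n z = complex_of_real (?a n z) * z powi k" for n z
    have f: "f n z = (c2 n * z powi (k + pos_freq n) + cnj (c2 n) * z powi (k - pos_freq n)) / of_nat (Suc n)"
      if z: "z \<in> circle" for n z
    proof -
      \<comment> \<open>The factor 2 in the density is absorbed here: twice a real part is the
        number plus its conjugate.\<close>
      have "complex_of_real (?a n z) = (c2 n * z powi pos_freq n + cnj (c2 n * z powi pos_freq n)) / of_nat (Suc n)"
        unfolding complex_add_cnj by (simp del: of_nat_Suc power_int_of_nat)
      also have "cnj (c2 n * z powi pos_freq n) = cnj (c2 n) * z powi (- pos_freq n)"
        by (simp only: complex_cnj_mult cnj_powi_circle[OF z])
      finally show ?thesis
        unfolding f_def diff_conv_add_uminus[of k] power_int_add[OF disjI1[OF circle_nonzero[OF z]]]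
        by (simp add: field_simps del: of_nat_Suc power_int_of_nat)
    qed
    have fc: "continuous_on circle (f n)" for n
      unfolding f_def by (auto intro!: continuous_intros simp del: of_nat_Suc)
    have fb: "norm (f n z) \<le> 2 * cmod (c2 n)" if "z \<in> circle" for n z
      using c2_term_le[OF that, of n] that unfolding f_def norm_mult norm_of_real by (simp add: norm_power_int)
    have "(\<lambda>n. LINT z|circle_haar. f n z) sums (LINT z|circle_haar. (\<Sum>n. f n z))"
    proof (rule sums_integral[OF haar_integrable[OF fc]])
      show "AE z in circle_haar. summable (\<lambda>n. norm (f n z))"
        by (rule AE_I2, rule summable_comparison_test'[OF summable_c2]) (use fb sp in auto)
      show "summable (\<lambda>n. LINT z|circle_haar. norm (f n z))"
      proof (rule summable_comparison_test'[OF summable_c2])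
        fix n
        have "(LINT z|circle_haar. norm (f n z)) \<le> (LINT z|circle_haar. 2 * cmod (c2 n))"
          using fb sp by (intro integral_mono integrable_norm haar_integrable[OF fc]) auto
        then show "norm (LINT z|circle_haar. norm (f n z)) \<le> 2 * cmod (c2 n)" by (simp add: prob_space)
      qed
    qed
    also have "(LINT z|circle_haar. (\<Sum>n. f n z)) = (LINT z|circle_haar. of_real (eq_density q2 z) * z powi k - z powi k)"
    proof (rule integral_circle_cong[OF cp])
      fix z :: complex assume z: "z \<in> circle"
      have "summable (\<lambda>n. ?a n z)"
        by (rule summable_comparison_test'[OF summable_c2]) (use c2_term_le[OF z] in auto)
      then have "(\<lambda>n. f n z) sums (of_real (\<Sum>n. ?a n z) * z powi k)"
        unfolding f_def by (intro sums_mult2 sums_of_real summable_sums)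
      then have "(\<Sum>n. f n z) = of_real (\<Sum>n. ?a n z) * z powi k" by (rule sums_unique[symmetric])
      then show "(\<Sum>n. f n z) = of_real (eq_density q2 z) * z powi k - z powi k"
        by (simp add: eq_density_def algebra_simps del: of_nat_Suc power_int_of_nat)
    qed
    also have "\<dots> = (LINT z|circle_haar. of_real (eq_density q2 z) * z powi k) - (LINT z|circle_haar. z powi k)"
    proof (rule Bochner_Integration.integral_diff)
      show "integrable circle_haar (\<lambda>z. z powi k)"
        by (rule haar_integrable) (auto intro!: continuous_intros)
      show "integrable circle_haar (\<lambda>z. complex_of_real (eq_density q2 z) * z powi k)"
        by (rule integrable_bounded_circle[OF cp, where B = "1 + (\<Sum>n. 2 * cmod (c2 n))"])
           (use measurable_eq_density measurable_powi_circle[OF cp] eq_density_abs_le in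
            \<open>auto simp: norm_mult norm_power_int simp del: of_nat_Suc\<close>)
    qed
    also have "(\<lambda>n. LINT z|circle_haar. f n z) = (\<lambda>n. (c2 n * (LINT z|circle_haar. z powi (k + pos_freq n)) + cnj (c2 n) * (LINT z|circle_haar. z powi (k - pos_freq n))) / of_nat (Suc n))"
    proof
      fix n
      have i: "integrable circle_haar (\<lambda>z. c * z powi j)" for c j
        by (rule haar_integrable) (auto intro!: continuous_intros)
      have "(LINT z|circle_haar. f n z) = (LINT z|circle_haar. (c2 n * z powi (k + pos_freq n) + cnj (c2 n) * z powi (k - pos_freq n)) / of_nat (Suc n))"
        by (rule integral_circle_cong[OF cp]) (rule f)
      then show "(LINT z|circle_haar. f n z) = (c2 n * (LINT z|circle_haar. z powi (k + pos_freq n)) + cnj (c2 n) * (LINT z|circle_haar. z powi (k - pos_freq n))) / of_nat (Suc n)"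
        by (simp only: integral_divide_zero Bochner_Integration.integral_add[OF i i] integral_mult_right_zero)
    qed
    finally show ?thesis .
  qed
  have "(\<lambda>n. 0) sums ((LINT z|circle_haar. complex_of_real (eq_density q2 z)) - 1)"
    using main[of 0] unfolding integral_circle_haar_powi by simp
  then show "(LINT z|circle_haar. of_real (eq_density q2 z)) = (1::complex)"
    using sums_unique2[OF sums_zero] by fastforce
  have "(\<lambda>n. if n = m then cnj (c2 n) / of_nat (Suc n) else 0) sums (LINT z|circle_haar. of_real (eq_density q2 z) * z powi pos_freq m)"
  proof -
    have "pos_freq m + pos_freq n \<noteq> 0" "pos_freq m - pos_freq n = 0 \<longleftrightarrow> n = m" "pos_freq m \<noteq> 0" for n by auto
    then have "(\<lambda>n. (c2 n * 0 + cnj (c2 n) * of_bool (n = m)) / of_nat (Suc n))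
      sums ((LINT z|circle_haar. of_real (eq_density q2 z) * z powi pos_freq m) - 0)"
      using main[of "pos_freq m"] unfolding integral_circle_haar_powi by (simp only: of_bool_eq)
    moreover have "(\<lambda>n. (c2 n * 0 + cnj (c2 n) * of_bool (n = m)) / of_nat (Suc n)) = (\<lambda>n. if n = m then cnj (c2 n) / of_nat (Suc n) else 0)"
      by auto
    ultimately show ?thesis by simp
  qed
  then show "(LINT z|circle_haar. of_real (eq_density q2 z) * z powi pos_freq m) = cnj (c2 m) / of_nat (Suc m)"
    by (rule sums_unique2[OF _ sums_single[of m "\<lambda>n. cnj (c2 n) / of_nat (Suc n)"]])
qed

text \<open>Together these conditions make the density nonnegative, so that
  \<open>eq_measure q2\<close> is an admissible competitor for the minimizer.\<close>

context
  fixes l :: real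
  assumes l: "\<And>z. z \<in> circle \<Longrightarrow> q2 z \<ge> - l" "2 * l \<le> 1"
begin

lemma eq_density_nonneg: "z \<in> circle \<Longrightarrow> 0 \<le> eq_density q2 z"
  using eq_density_ge[OF l(1), of z] l(2) by simp

lemma integral_eq_measure:
  fixes h :: "complex \<Rightarrow> 'b::{banach, second_countable_topology}"
  assumes "h \<in> borel_measurable circle_haar"
  shows "(LINT z|eq_measure q2. h z) = (LINT z|circle_haar. eq_density q2 z *\<^sub>R h z)"
  unfolding eq_measure_def using assms measurable_eq_density
  by (rule integral_density)
     (auto intro!: AE_I2 eq_density_nonneg simp: space_circle_prob[OF circle_prob_circle_haar])

lemma circle_prob_eq_measure: "circle_prob (eq_measure q2)"
  unfolding circle_prob_def
proof
  have s: "sets (eq_measure q2) = sets circle_borel"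
    by (simp add: eq_measure_def circle_prob_sets[OF circle_prob_circle_haar])
  then show "sets (eq_measure q2) = sets circle_borel" .
  have i: "integrable circle_haar (eq_density q2)"
    by (rule integrable_bounded_circle[OF circle_prob_circle_haar measurable_eq_density])
       (use eq_density_abs_le in auto)
  have "complex_of_real (LINT z|circle_haar. eq_density q2 z) = 1"
    using integral_eq_density_powi(1) by simp
  then have 1: "(LINT z|circle_haar. eq_density q2 z) = 1" by (simp only: of_real_eq_1_iff)
  show "prob_space (eq_measure q2)"
  proof
    have "emeasure (eq_measure q2) (space (eq_measure q2)) = (\<integral>\<^sup>+z. ennreal (eq_density q2 z) \<partial>circle_haar)"
      unfolding eq_measure_def using measurable_eq_density
      by (subst emeasure_density) (auto intro!: nn_integral_cong)
    also have "\<dots> = ennreal (LINT z|circle_haar. eq_density q2 z)"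
      by (rule nn_integral_eq_integral[OF i])
         (auto intro!: AE_I2 eq_density_nonneg simp: space_circle_prob[OF circle_prob_circle_haar])
    finally show "emeasure (eq_measure q2) (space (eq_measure q2)) = 1" using 1 by simp
  qed
qed

lemma moment_eq_measure: "moment (eq_measure q2) n = cnj (c2 n) / of_nat (Suc n)"
  unfolding moment_def
  by (subst integral_eq_measure)
     (simp_all only: measurable_powi_circle[OF circle_prob_circle_haar] scaleR_conv_of_real integral_eq_density_powi(2))

text \<open>The candidate is designed for this. Two differentiations multiply the coefficient of
  \<open>Q\<close> at n + 1 by -(n + 1)^2, so that this coefficient is minus the conjugate moment of
  the candidate divided by n + 1. Up to a constant, the linear part of the energy is thus -2 times
  an inner product with the candidate, in the weights 1/(n + 1).\<close>

lemma potential_integral: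
  assumes M: "circle_prob M"
  shows "(\<lambda>n. 2 * Re (cnj (moment (eq_measure q2) n) * moment M n) / real (Suc n))
    sums (Re (fourier (\<lambda>z. of_real (Q z)) 0) - (LINT z|M. Q z))"
proof -
  interpret prob_space M using M by (rule circle_prob_prob_space)
  let ?q = "fourier (\<lambda>z. of_real (Q z))"
  have q: "?q (pos_freq n) = - cnj (moment (eq_measure q2) n) / of_nat (Suc n)" for n
  proof -
    have "c2 n = - (of_nat (Suc n))\<^sup>2 * ?q (pos_freq n)"
      unfolding fourier_deriv[OF Q(2)] fourier_deriv[OF Q(1)]
      by (simp add: power2_eq_square algebra_simps del: of_nat_Suc)
    then have "cnj (moment (eq_measure q2) n) = - of_nat (Suc n) * ?q (pos_freq n)"
      unfolding moment_eq_measure by (simp add: power2_eq_square del: of_nat_Suc)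
    then show ?thesis by (simp add: field_simps del: of_nat_Suc)
  qed
  have "(\<lambda>n. ?q (pos_freq n) * moment M n + ?q (neg_freq n) * cnj (moment M n))
     sums ((LINT z|M. of_real (Q z)) - ?q 0)"
    using fourier_series_integral[OF M Q(1), of "\<lambda>_. 1"] 
    unfolding mult_1 moment_def[symmetric] moment_neg[OF M] by (simp add: prob_space exI[of _ 1] del: of_nat_Suc power_int_of_nat)
  from sums_minus[OF sums_Re[OF this]]
  have "(\<lambda>n. - Re (?q (pos_freq n) * moment M n + ?q (neg_freq n) * cnj (moment M n)))
     sums (Re (?q 0) - (LINT z|M. Q z))" by simp
  moreover have "- Re (?q (pos_freq n) * moment M n + ?q (neg_freq n) * cnj (moment M n))
     = 2 * Re (cnj (moment (eq_measure q2) n) * moment M n) / real (Suc n)" for n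
  proof -
    have "?q (pos_freq n) * moment M n + ?q (neg_freq n) * cnj (moment M n)
      = ?q (pos_freq n) * moment M n + cnj (?q (pos_freq n) * moment M n)"
      by (simp only: fourier_of_real_neg complex_cnj_mult)
    also have "\<dots> = of_real (2 * Re (?q (pos_freq n) * moment M n))"
      by (rule complex_add_cnj)
    finally have sym: "?q (pos_freq n) * moment M n + ?q (neg_freq n) * cnj (moment M n)
      = of_real (2 * Re (?q (pos_freq n) * moment M n))" .
    have "?q (pos_freq n) * moment M n = of_real (- 1 / real (Suc n)) * (cnj (moment (eq_measure q2) n) * moment M n)"
      unfolding q by (simp del: of_nat_Suc)
    also have "Re \<dots> = - 1 / real (Suc n) * Re (cnj (moment (eq_measure q2) n) * moment M n)"
      by (simp only: Re_complex_of_real Im_complex_of_real times_complex.sel(1)[of "complex_of_real _"] mult_zero_left diff_zero)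
    finally have "Re (?q (pos_freq n) * moment M n) = - 1 / real (Suc n) * Re (cnj (moment (eq_measure q2) n) * moment M n)" .
    then show ?thesis unfolding sym Re_complex_of_real by simp
  qed
  ultimately show ?thesis by simp
qed

text \<open>Completing the square: minimality forces the weighted sum of the squared distances
  between the two moment sequences to be at most 0, and since the weights are positive every term
  vanishes.\<close>

lemma moment_equilibrium:
  assumes mu: "is_equilibrium_measure Q \<mu>"
  shows "moment \<mu> n = moment (eq_measure q2) n"
proof -
  have M: "circle_prob \<mu>" using mu by (simp add: is_equilibrium_measure_def)
  let ?m = "moment \<mu>" and ?v = "moment (eq_measure q2)"
  define q0 where "q0 = Re (fourier (\<lambda>z. of_real (Q z)) 0)"
  \<comment> \<open>Half, because \<open>potential_integral\<close> applied to the candidate itself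
    sums to twice its weighted square norm.\<close>
  define C where "C = (q0 - (LINT z|eq_measure q2. Q z)) / 2"
  have half: "2 * x / b / 2 = x / b" for x b :: real by simp
  have Rc: "Re (cnj v * v) = (cmod v)\<^sup>2" for v
    unfolding cmod_power2 by (simp add: power2_eq_square)
  have "(\<lambda>n. 2 * Re (cnj (?v n) * ?v n) / real (Suc n)) sums (q0 - (LINT z|eq_measure q2. Q z))"
    using potential_integral[OF circle_prob_eq_measure] unfolding q0_def .
  from sums_divide[OF this, of 2]
  have C: "(\<lambda>n. (cmod (?v n))\<^sup>2 / real (Suc n)) sums C"
    unfolding C_def Rc half .
  have "log_energy Q \<mu> \<le> log_energy Q (eq_measure q2)"
    using mu circle_prob_eq_measure by (simp add: is_equilibrium_measure_def)
  also have "\<dots> \<le> ereal ((LINT x|eq_measure q2. Q x) + C)" by (rule log_energy_le[OF circle_prob_eq_measure C])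
  finally have E: "log_energy Q \<mu> \<le> ereal ((LINT x|eq_measure q2. Q x) + C)" .
  define S where "S = q0 - (LINT z|\<mu>. Q z)"
  have S: "(\<lambda>n. 2 * Re (cnj (?v n) * ?m n) / real (Suc n)) sums S"
    using potential_integral[OF M] unfolding q0_def S_def .
  \<comment> \<open>In terms of \<open>S\<close> and \<open>C\<close> the integrals of
    \<open>Q\<close> are \<open>q0 - S\<close> and \<open>q0 - 2 * C\<close>, so \<open>q0\<close>
    cancels from the comparison of energies.\<close>
  have le: "(\<Sum>n<N. (cmod (?m n))\<^sup>2 / real (Suc n)) \<le> S - C" for N
    using log_energy_ge[OF M E, of N] unfolding S_def C_def by (simp add: field_simps)
  have sm: "summable (\<lambda>n. (cmod (?m n))\<^sup>2 / real (Suc n))"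
    by (rule summableI_nonneg_bounded[OF _ le]) simp
  have "(\<lambda>n. (cmod (?m n))\<^sup>2 / real (Suc n) - 2 * Re (cnj (?v n) * ?m n) / real (Suc n) + (cmod (?v n))\<^sup>2 / real (Suc n))
    sums ((\<Sum>n. (cmod (?m n))\<^sup>2 / real (Suc n)) - S + C)"
    by (intro sums_add sums_diff summable_sums sm S C)
  moreover have "(cmod (?m n))\<^sup>2 / real (Suc n) - 2 * Re (cnj (?v n) * ?m n) / real (Suc n) + (cmod (?v n))\<^sup>2 / real (Suc n)
    = (cmod (?m n - ?v n))\<^sup>2 / real (Suc n)" for n
  proof -
    have "(cmod (?m n - ?v n))\<^sup>2 = (cmod (?m n))\<^sup>2 - 2 * Re (cnj (?v n) * ?m n) + (cmod (?v n))\<^sup>2"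
      unfolding cmod_power2 by (simp add: power2_diff algebra_simps)
    then show ?thesis by (simp only: add_divide_distrib diff_divide_distrib)
  qed
  ultimately have sums: "(\<lambda>n. (cmod (?m n - ?v n))\<^sup>2 / real (Suc n)) sums ((\<Sum>n. (cmod (?m n))\<^sup>2 / real (Suc n)) - S + C)"
    by simp
  have "(\<Sum>n. (cmod (?m n))\<^sup>2 / real (Suc n)) \<le> S - C"
    by (rule suminf_le_const[OF sm le])
  then have "(\<Sum>n. (cmod (?m n - ?v n))\<^sup>2 / real (Suc n)) = 0"
    using sums suminf_nonneg[OF sums_summable[OF sums]] unfolding sums_unique[OF sums, symmetric]
    by (intro antisym) auto
  then have "(cmod (?m n - ?v n))\<^sup>2 / real (Suc n) = 0"
    using suminf_eq_zero_iff[OF sums_summable[OF sums]] by simp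
  then show ?thesis by simp
qed

text \<open>Equal moments give both integrals the same Fourier expansion; conjugation supplies the
  negative frequencies.\<close>

lemma integral_equilibrium:
  assumes mu: "is_equilibrium_measure Q \<mu>" and h: "circle_C1 h h'"
  shows "(LINT z|\<mu>. h z) = (LINT z|eq_measure q2. h z)"
proof -
  have M: "circle_prob \<mu>" using mu by (simp add: is_equilibrium_measure_def)
  have s: "(\<lambda>n. fourier h (pos_freq n) * moment N n + fourier h (neg_freq n) * cnj (moment N n))
     sums ((LINT z|N. h z) - fourier h 0)" if N: "circle_prob N" for N
  proof -
    interpret prob_space N using N by (rule circle_prob_prob_space)
    show ?thesis
      using fourier_series_integral[OF N h, of "\<lambda>_. 1"]
      unfolding mult_1 moment_def[symmetric] moment_neg[OF N] by (simp add: prob_space exI[of _ 1] del: of_nat_Suc power_int_of_nat)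
  qed
  have "(LINT z|\<mu>. h z) - fourier h 0 = (LINT z|eq_measure q2. h z) - fourier h 0"
    using sums_unique2[OF s[OF M, unfolded moment_equilibrium[OF mu]] s[OF circle_prob_eq_measure]] .
  then show ?thesis by simp
qed

end

end

theorem theorem4:
  fixes Q :: "complex \<Rightarrow> real" and \<rho> :: real and \<mu> :: "complex measure"
    and \<phi> :: "complex \<Rightarrow> complex"
  assumes "C_k_on_circle 3 Q"
    and "\<rho> > 0"
    and "\<forall>z\<in>circle. circle_deriv (circle_deriv Q) z \<ge> \<rho> - 1 / 2"
    and "is_equilibrium_measure Q \<mu>"
    and "smooth_on_circle \<phi>"
  shows "2 * \<rho> * (LINT z|circle_haar. LINT w|circle_haar.
             (cmod ((\<phi> z - \<phi> w) / (z - w)))\<^sup>2)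
       \<le> (LINT z|\<mu>. (cmod (circle_deriv \<phi> z - (LINT w|\<mu>. circle_deriv \<phi> w)))\<^sup>2)"
proof -
  have Q0: "C_k_on_circle (Suc (Suc (Suc 0))) Q" using assms(1) by (simp add: numeral_3_eq_3)
  define q2 where "q2 = circle_deriv (circle_deriv Q)"
  have Q1: "C_k_on_circle (Suc (Suc 0)) (circle_deriv Q)" and Q2: "C_k_on_circle (Suc 0) q2"
    using Q0 unfolding q2_def by simp_all
  have "C_k_on_circle (Suc 0) Q" "C_k_on_circle (Suc 0) (circle_deriv Q)"
    using Q0 Q1 C_k_on_circle_continuous_real[of "Suc (Suc 0)" "circle_deriv Q"]
      C_k_on_circle_continuous_real[of "Suc 0" "circle_deriv (circle_deriv Q)"] by simp_all
  note C = this[THEN circle_C1_real, folded q2_def] circle_C1_real[OF Q2]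
  \<comment> \<open>With this \<open>l\<close> the hypothesis on the second derivative reads
    \<open>q2 z \<ge> - l\<close>, the lower bound \<open>1 - 2 * l\<close> for the density is
    \<open>2 * \<rho>\<close>, and positivity of \<open>\<rho>\<close> gives
    \<open>2 * l \<le> 1\<close>.\<close>
  define l where "l = 1 / 2 - \<rho>"
  have l: "z \<in> circle \<Longrightarrow> q2 z \<ge> - l" "2 * l \<le> 1" for z
    using assms(2,3) by (auto simp: q2_def l_def)
  have "C_k_on_circle (Suc (Suc 0)) \<phi>" using assms(5) by (simp only: smooth_on_circle_def)
  then have "C_k_on_circle (Suc 0) \<phi>" "C_k_on_circle (Suc 0) (circle_deriv \<phi>)"
    using C_k_on_circle_continuous_complex[of "Suc 0" "circle_deriv \<phi>"] by simp_all
  note phi = this[THEN circle_C1_complex]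
  \<comment> \<open>The mean is taken with respect to \<open>\<mu>\<close> while the Dirichlet bound
    concerns Haar measure; this is why \<open>dirichlet_le\<close> is stated for every
    constant.\<close>
  define c where "c = (LINT w|\<mu>. circle_deriv \<phi> w)"
  define H where "H z = (cmod (circle_deriv \<phi> z - c))\<^sup>2" for z
  have Hc: "continuous_on circle H"
    unfolding H_def using circle_C1_continuous[OF phi(2)] by (intro continuous_intros)
  obtain B where B: "B \<ge> 0" "\<And>z. z \<in> circle \<Longrightarrow> norm (H z) \<le> B"
    using continuous_circle_bounded[OF Hc] by metis
  have "2 * \<rho> * (LINT z|circle_haar. LINT w|circle_haar. (cmod ((\<phi> z - \<phi> w) / (z - w)))\<^sup>2)
      \<le> 2 * \<rho> * (LINT z|circle_haar. H z)"
    unfolding H_def using assms(2) by (intro mult_left_mono dirichlet_le[OF phi(1)]) auto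
  also have "\<dots> = (LINT z|circle_haar. 2 * \<rho> * H z)" by simp
  also have "\<dots> \<le> (LINT z|circle_haar. eq_density q2 z * H z)"
  proof (rule integral_mono)
    show "integrable circle_haar (\<lambda>z. 2 * \<rho> * H z)"
      using haar_integrable[OF Hc] by simp
    show "integrable circle_haar (\<lambda>z. eq_density q2 z * H z)"
      by (rule integrable_bounded_circle[OF circle_prob_circle_haar, where B = "(1 + (\<Sum>n. 2 * cmod (fourier (\<lambda>w. of_real (q2 w)) (pos_freq n)))) * B"])
         (use measurable_eq_density[OF C] haar_measurable[OF Hc] eq_density_abs_le[OF C] B in
          \<open>auto simp: abs_mult intro!: mult_mono simp del: of_nat_Suc intro: order_trans[OF abs_ge_zero]\<close>)
    fix z assume "z \<in> space circle_haar"
    then have "z \<in> circle" by (simp add: space_circle_prob[OF circle_prob_circle_haar])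
    then show "2 * \<rho> * H z \<le> eq_density q2 z * H z"
      using eq_density_ge[OF C l(1)] by (intro mult_right_mono) (auto simp: l_def H_def)
  qed
  also have "\<dots> = (LINT z|eq_measure q2. H z)"
    by (subst integral_eq_measure[OF C l haar_measurable[OF Hc]]) simp_all
  also have "\<dots> = (LINT z|\<mu>. H z)"
  proof -
    have "complex_of_real (LINT z|\<mu>. H z) = complex_of_real (LINT z|eq_measure q2. H z)"
      using integral_equilibrium[OF C l assms(4) circle_C1_norm_square[OF phi(2), of c]]
      unfolding H_def[symmetric] by simp
    then show ?thesis by (simp only: of_real_eq_iff)
  qed
  finally show ?thesis by (simp only: H_def c_def)
qed

end
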